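(* Let $G$ be a discrete amenable group and let $u:G\to B(H)$ be a partial representation of $G$ on a Hilbert space $H$. Then there exist a Hilbert space $H^{e}$ containing $H$ as a Hilbert subspace and a unitary representation $u^{e}:G\to B(H^{e})$ such that $u_t=P\,u^{e}_t\,i$ for all $t\in G$, where $P:H^{e}\to H$ is the orthogonal projection of $H^{e}$ onto $H$ and $i:H\to H^{e}$ is the natural inclusion. In particular, the partial representations of a discrete amenable group are positive definite maps.
   Context: A partial representation of a discrete group $G$ on a Hilbert space $H$ is a map $u:G\to B(H)$ such that for all $s,t\in G$: (i) $u_e=\mathrm{id}_H$; (ii) $u_{t^{-1}}=u_t^*$; (iii) $u_su_tu_{t^{-1}}=u_{st}u_{t^{-1}}$. *)

theory Defs
  imports "HOL-Analysis.Analysis" "HOL-Algebra.Algebraic_Closure_Type"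
begin

text \<open>
  Hilbert spaces are set-based (a carrier inside a type), because the dilation asserts the existence
  of a Hilbert space, and types cannot be quantified existentially.  As in HOL-Algebra, the vector
  space operations come from the record \<^type>\<open>module\<close>, whose fields \<^const>\<open>mult\<close> and \<^const>\<open>one\<close>
  carry no information.  The inner product is linear in its first argument.
\<close>

record 'a hilbert = "(complex, 'a) module" +
  inner_prod :: "'a \<Rightarrow> 'a \<Rightarrow> complex"

abbreviation complex_field :: "complex ring" where
  "complex_field \<equiv> ring_of_type_algebra"

definition hnorm :: "'a hilbert \<Rightarrow> 'a \<Rightarrow> real" where
  "hnorm H x = sqrt (Re (inner_prod H x x))"

locale hilbert_space = module complex_field H for H :: "'a hilbert" (structure) +
  assumes inner_add_left:
      "\<lbrakk>x \<in> carrier H; y \<in> carrier H; z \<in> carrier H\<rbrakk>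
        \<Longrightarrow> inner_prod H (x \<oplus> y) z = inner_prod H x z + inner_prod H y z"
    and inner_smult_left:
      "\<lbrakk>x \<in> carrier H; y \<in> carrier H\<rbrakk>
        \<Longrightarrow> inner_prod H (c \<odot> x) y = c * inner_prod H x y"
    and inner_cnj:
      "\<lbrakk>x \<in> carrier H; y \<in> carrier H\<rbrakk> \<Longrightarrow> inner_prod H y x = cnj (inner_prod H x y)"
    and inner_nonneg: "x \<in> carrier H \<Longrightarrow> inner_prod H x x \<in> \<real>\<^sub>\<ge>\<^sub>0"
    and inner_definite: "\<lbrakk>x \<in> carrier H; inner_prod H x x = 0\<rbrakk> \<Longrightarrow> x = \<zero>"
    and complete:
      "\<lbrakk>\<And>n. \<xi> n \<in> carrier H;
        \<And>e. e > 0 \<Longrightarrow> \<exists>N. \<forall>m\<ge>N. \<forall>n\<ge>N. hnorm H (\<xi> m \<ominus> \<xi> n) < e\<rbrakk>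
        \<Longrightarrow> \<exists>x\<in>carrier H. (\<lambda>n. hnorm H (\<xi> n \<ominus> x)) \<longlonglongrightarrow> 0"

definition linear_map :: "'a hilbert \<Rightarrow> 'b hilbert \<Rightarrow> ('a \<Rightarrow> 'b) \<Rightarrow> bool" where
  "linear_map H K T \<longleftrightarrow>
     (\<forall>x\<in>carrier H. T x \<in> carrier K) \<and>
     (\<forall>x\<in>carrier H. \<forall>y\<in>carrier H. T (x \<oplus>\<^bsub>H\<^esub> y) = T x \<oplus>\<^bsub>K\<^esub> T y) \<and>
     (\<forall>c. \<forall>x\<in>carrier H. T (c \<odot>\<^bsub>H\<^esub> x) = c \<odot>\<^bsub>K\<^esub> T x)"

text \<open>Membership in \<open>B(H)\<close>.  Values of an operator outside the carrier are irrelevant throughout, so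
  equality of operators is always stated pointwise on the carrier.\<close>

definition bounded_operator :: "'a hilbert \<Rightarrow> ('a \<Rightarrow> 'a) \<Rightarrow> bool" where
  "bounded_operator H T \<longleftrightarrow>
     linear_map H H T \<and> (\<exists>C. \<forall>x\<in>carrier H. hnorm H (T x) \<le> C * hnorm H x)"

text \<open>\<open>is_adjoint H T S\<close> says that \<open>S\<close> is the adjoint of \<open>T\<close>.\<close>

definition is_adjoint :: "'a hilbert \<Rightarrow> ('a \<Rightarrow> 'a) \<Rightarrow> ('a \<Rightarrow> 'a) \<Rightarrow> bool" where
  "is_adjoint H T S \<longleftrightarrow> bounded_operator H S \<and>
     (\<forall>x\<in>carrier H. \<forall>y\<in>carrier H. inner_prod H (T x) y = inner_prod H x (S y))"

definition unitary_operator :: "'a hilbert \<Rightarrow> ('a \<Rightarrow> 'a) \<Rightarrow> bool" where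
  "unitary_operator H U \<longleftrightarrow> bounded_operator H U \<and>
     (\<exists>V. is_adjoint H U V \<and> (\<forall>x\<in>carrier H. U (V x) = x \<and> V (U x) = x))"

text \<open>The inclusion of a Hilbert subspace, up to identifying \<open>H\<close> with its image under \<open>i\<close>.\<close>

definition hilbert_embedding :: "'a hilbert \<Rightarrow> 'b hilbert \<Rightarrow> ('a \<Rightarrow> 'b) \<Rightarrow> bool" where
  "hilbert_embedding H K i \<longleftrightarrow> linear_map H K i \<and>
     (\<forall>x\<in>carrier H. \<forall>y\<in>carrier H. inner_prod K (i x) (i y) = inner_prod H x y)"

text \<open>\<open>P\<close> is the orthogonal projection of \<open>K\<close> onto \<open>H\<close>, with \<open>H\<close> regarded as a subspace via \<open>i\<close>:
  \<open>i (P x)\<close> is the point of \<open>i(H)\<close> for which \<open>x - i (P x)\<close> is orthogonal to \<open>i(H)\<close>.\<close>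

definition orthogonal_projection ::
  "'a hilbert \<Rightarrow> 'b hilbert \<Rightarrow> ('a \<Rightarrow> 'b) \<Rightarrow> ('b \<Rightarrow> 'a) \<Rightarrow> bool" where
  "orthogonal_projection H K i P \<longleftrightarrow>
     (\<forall>x\<in>carrier K. P x \<in> carrier H \<and>
        (\<forall>y\<in>carrier H. inner_prod K (x \<ominus>\<^bsub>K\<^esub> i (P x)) (i y) = 0))"

text \<open>The bounded functions on \<open>G\<close>.  Their values outside \<open>carrier G\<close> are arbitrary; the first clause
  of \<open>left_invariant_mean\<close> makes a mean insensitive to them.\<close>

definition linfty :: "'g monoid \<Rightarrow> ('g \<Rightarrow> complex) set" where
  "linfty G = {f. bounded (f ` carrier G)}"

definition left_invariant_mean :: "'g monoid \<Rightarrow> (('g \<Rightarrow> complex) \<Rightarrow> complex) \<Rightarrow> bool" where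
  "left_invariant_mean G M \<longleftrightarrow>
     (\<forall>f\<in>linfty G. \<forall>g\<in>linfty G. (\<forall>x\<in>carrier G. f x = g x) \<longrightarrow> M f = M g) \<and>
     (\<forall>f\<in>linfty G. \<forall>g\<in>linfty G. M (\<lambda>x. f x + g x) = M f + M g) \<and>
     (\<forall>c. \<forall>f\<in>linfty G. M (\<lambda>x. c * f x) = c * M f) \<and>
     (\<forall>f\<in>linfty G. (\<forall>x\<in>carrier G. f x \<in> \<real>\<^sub>\<ge>\<^sub>0) \<longrightarrow> M f \<in> \<real>\<^sub>\<ge>\<^sub>0) \<and>
     M (\<lambda>x. 1) = 1 \<and>
     (\<forall>t\<in>carrier G. \<forall>f\<in>linfty G. M (\<lambda>x. f (t \<otimes>\<^bsub>G\<^esub> x)) = M f)"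

definition amenable_group :: "'g monoid \<Rightarrow> bool" where
  "amenable_group G \<longleftrightarrow> group G \<and> (\<exists>M. left_invariant_mean G M)"

definition partial_representation ::
  "'g monoid \<Rightarrow> 'a hilbert \<Rightarrow> ('g \<Rightarrow> 'a \<Rightarrow> 'a) \<Rightarrow> bool" where
  "partial_representation G H u \<longleftrightarrow>
     (\<forall>t\<in>carrier G. bounded_operator H (u t)) \<and>
     (\<forall>x\<in>carrier H. u \<one>\<^bsub>G\<^esub> x = x) \<and>
     (\<forall>t\<in>carrier G. is_adjoint H (u t) (u (inv\<^bsub>G\<^esub> t))) \<and>
     (\<forall>s\<in>carrier G. \<forall>t\<in>carrier G. \<forall>x\<in>carrier H.
        u s (u t (u (inv\<^bsub>G\<^esub> t) x)) = u (s \<otimes>\<^bsub>G\<^esub> t) (u (inv\<^bsub>G\<^esub> t) x))"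

definition unitary_representation ::
  "'g monoid \<Rightarrow> 'a hilbert \<Rightarrow> ('g \<Rightarrow> 'a \<Rightarrow> 'a) \<Rightarrow> bool" where
  "unitary_representation G H v \<longleftrightarrow>
     (\<forall>t\<in>carrier G. unitary_operator H (v t)) \<and>
     (\<forall>x\<in>carrier H. v \<one>\<^bsub>G\<^esub> x = x) \<and>
     (\<forall>s\<in>carrier G. \<forall>t\<in>carrier G. \<forall>x\<in>carrier H. v (s \<otimes>\<^bsub>G\<^esub> t) x = v s (v t x))"

text \<open>A map \<open>G \<rightarrow> B(H)\<close> is positive definite if every operator matrix \<open>(u (t\<^sub>i\<inverse> t\<^sub>j))\<^sub>i\<^sub>j\<close> is
  positive on \<open>H\<^sup>n\<close>; the double sum is its quadratic form at \<open>(h 0, \<dots>, h (n - 1))\<close>.\<close>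

definition positive_definite ::
  "'g monoid \<Rightarrow> 'a hilbert \<Rightarrow> ('g \<Rightarrow> 'a \<Rightarrow> 'a) \<Rightarrow> bool" where
  "positive_definite G H u \<longleftrightarrow>
     (\<forall>t\<in>carrier G. bounded_operator H (u t)) \<and>
     (\<forall>(n::nat) t h. (\<forall>i<n. t i \<in> carrier G \<and> h i \<in> carrier H) \<longrightarrow>
        (\<Sum>i<n. \<Sum>j<n. inner_prod H (u (inv\<^bsub>G\<^esub> t i \<otimes>\<^bsub>G\<^esub> t j) (h j)) (h i)) \<in> \<real>\<^sub>\<ge>\<^sub>0)"

end

theory Submission
  imports Defs
begin

text \<open>
  The dilation is a Kolmogorov decomposition, so the point is the positive definiteness of \<open>u\<close>.
  Write \<open>k(s, t) = u (s\<inverse> t)\<close>. The axioms give \<open>k(r, s) k(s, t) = k(r, t) k(t, s) k(s, t)\<close>, so for a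
  fixed \<open>r\<close> and the projections \<open>e\<^sub>t = k(t, r) k(r, t)\<close> the Schur complement \<open>k(s, t) - k(s, r) k(r, t)\<close>
  equals \<open>(1 - e\<^sub>s) k(s, t) (1 - e\<^sub>t)\<close>. This removes one group element from the quadratic form at the
  cost of a Gram matrix, and induction on the number of group elements concludes.
\<close>

section \<open>Semi-inner product spaces\<close>

text \<open>The Schur complement formula holds because the projections slide through the kernel: the
  axioms give k(s, r) k(r, t) = k(s, t) e_t, adjoints turn this into e_s k(s, t), and e_t is
  idempotent. Since e_r = 1, the row and the column of r vanish after the reduction, which is what
  lets the induction descend. The form of the dilation is dictated by types: its vectors have to be
  elements of a type fixed in advance, here \<open>'g \<Rightarrow> 'h\<close>. Limits of formal
  combinations of translates of H are naturally functionals on lists. The Hilbert space is built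
  from these, which avoids a quotient by null vectors, and is then moved along the map that sends a
  vector F to its coefficients P U(t^-1) F. That map is injective because the translates of H span a
  dense subspace.\<close>

text \<open>No vector space axioms are required of \<open>add\<close> and \<open>scale\<close>: everything is measured by \<open>q\<close>. Hence
  lists, with concatenation as addition, are admissible formal linear combinations.\<close>

locale semi_inner_space =
  fixes V :: "'v set" and add :: "'v \<Rightarrow> 'v \<Rightarrow> 'v" and scale :: "complex \<Rightarrow> 'v \<Rightarrow> 'v"
    and q :: "'v \<Rightarrow> 'v \<Rightarrow> complex"
  assumes add_closed [simp]: "\<lbrakk>x \<in> V; y \<in> V\<rbrakk> \<Longrightarrow> add x y \<in> V"
    and scale_closed [simp]: "x \<in> V \<Longrightarrow> scale c x \<in> V"
    and q_add_left [simp]: "\<lbrakk>x \<in> V; y \<in> V; z \<in> V\<rbrakk> \<Longrightarrow> q (add x y) z = q x z + q y z"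
    and q_scale_left [simp]: "\<lbrakk>x \<in> V; y \<in> V\<rbrakk> \<Longrightarrow> q (scale c x) y = c * q x y"
    and q_cnj: "\<lbrakk>x \<in> V; y \<in> V\<rbrakk> \<Longrightarrow> q y x = cnj (q x y)"
    and q_nonneg: "x \<in> V \<Longrightarrow> q x x \<in> \<real>\<^sub>\<ge>\<^sub>0"
begin

definition snorm :: "'v \<Rightarrow> real" where
  "snorm x = sqrt (Re (q x x))"

definition diff :: "'v \<Rightarrow> 'v \<Rightarrow> 'v" where
  "diff x y = add x (scale (-1) y)"

definition cauchy :: "(nat \<Rightarrow> 'v) \<Rightarrow> bool" where
  "cauchy v \<longleftrightarrow> (\<forall>e>0. \<exists>N. \<forall>m\<ge>N. \<forall>n\<ge>N. snorm (diff (v m) (v n)) < e)"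

lemma q_add_right [simp]: "\<lbrakk>x \<in> V; y \<in> V; z \<in> V\<rbrakk> \<Longrightarrow> q x (add y z) = q x y + q x z"
  by (metis add_closed complex_cnj_add q_add_left q_cnj)

lemma q_scale_right [simp]: "\<lbrakk>x \<in> V; y \<in> V\<rbrakk> \<Longrightarrow> q x (scale c y) = cnj c * q x y"
  by (metis complex_cnj_mult q_cnj q_scale_left scale_closed)

lemma diff_closed [simp]: "\<lbrakk>x \<in> V; y \<in> V\<rbrakk> \<Longrightarrow> diff x y \<in> V"
  by (simp add: diff_def)

lemma q_diff_left [simp]: "\<lbrakk>x \<in> V; y \<in> V; z \<in> V\<rbrakk> \<Longrightarrow> q (diff x y) z = q x z - q y z"
  by (simp add: diff_def)

lemma q_diff_right [simp]: "\<lbrakk>x \<in> V; y \<in> V; z \<in> V\<rbrakk> \<Longrightarrow> q x (diff y z) = q x y - q x z"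
  by (simp add: diff_def)

lemma Re_q_nonneg: "x \<in> V \<Longrightarrow> 0 \<le> Re (q x x)"
  using q_nonneg by (auto simp: complex_nonneg_Reals_iff)

lemma q_self: "x \<in> V \<Longrightarrow> q x x = of_real ((snorm x)\<^sup>2)"
  using q_nonneg[of x] Re_q_nonneg[of x]
  by (auto simp: complex_nonneg_Reals_iff snorm_def complex_eq_iff simp flip: of_real_power)

lemma snorm_power2: "x \<in> V \<Longrightarrow> (snorm x)\<^sup>2 = Re (q x x)"
  by (simp add: snorm_def Re_q_nonneg)

lemma snorm_nonneg [simp]: "x \<in> V \<Longrightarrow> 0 \<le> snorm x"
  by (simp add: snorm_def Re_q_nonneg)

text \<open>As \<open>add\<close> and \<open>scale\<close> obey no laws, a rearranged sum may be a
  different element of \<open>V\<close>. Only the values of \<open>q\<close> agree, and this rule is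
  how rearrangements enter the norm estimates.\<close>

lemma snorm_eqI:
  assumes "x \<in> V" "q x x = q y y"
  shows "snorm x = snorm y"
  using assms by (simp add: snorm_def)

text \<open>The form may be degenerate, so the usual division by \<open>q y y\<close> covers only
  one case; if that value is 0, positivity along the whole line through \<open>x\<close> in
  direction \<open>y\<close> forces \<open>q x y = 0\<close>.\<close>

lemma Cauchy_Schwarz:
  assumes x: "x \<in> V" and y: "y \<in> V"
  shows "cmod (q x y) \<le> snorm x * snorm y"
proof -
  let ?a = "Re (q x x)" and ?b = "Re (q y y)" and ?g = "q x y"
  have expand: "0 \<le> ?a + 2 * Re (c * ?g) + (cmod c)\<^sup>2 * ?b" for c
  proof -
    let ?z = "add x (scale (cnj c) y)"
    have "q ?z ?z = q x x + c * ?g + cnj c * cnj ?g + c * cnj c * q y y"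
      using x y by (simp add: q_cnj[OF x y] algebra_simps)
    also have "\<dots> = q x x + c * ?g + cnj (c * ?g) + of_real ((cmod c)\<^sup>2) * q y y"
      by (simp add: complex_norm_square flip: of_real_power)
    finally have "Re (q ?z ?z) = ?a + 2 * Re (c * ?g) + (cmod c)\<^sup>2 * ?b"
      by simp
    then show ?thesis
      using Re_q_nonneg[of ?z] x y by simp
  qed
  have "(cmod ?g)\<^sup>2 \<le> ?a * ?b"
  proof (cases "?b = 0")
    case True
    \<comment> \<open>The scalar \<open>- r * cnj ?g\<close> makes the linear term of
      \<open>expand\<close> real and negative, while the quadratic term is absent.\<close>
    have bound: "2 * r * (cmod ?g)\<^sup>2 \<le> ?a" for r :: real
    proof -
      have "- of_real r * cnj ?g * ?g = of_real (- r * (cmod ?g)\<^sup>2)"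
        by (simp add: complex_norm_square mult_ac del: of_real_power)
      then have "Re (- of_real r * cnj ?g * ?g) = - r * (cmod ?g)\<^sup>2"
        by (simp only: Re_complex_of_real)
      then show ?thesis
        using expand[of "- of_real r * cnj ?g"] True by simp
    qed
    have "?g = 0"
    proof (rule ccontr)
      assume "?g \<noteq> 0"
      \<comment> \<open>With this \<open>r\<close> the bound reads 2(a + 1) \<le> a, impossible for
        a \<ge> 0.\<close>
      then show False
        using bound[of "(?a + 1) / (cmod ?g)\<^sup>2"] Re_q_nonneg[OF x] by simp
    qed
    then show ?thesis using True by simp
  next
    case False
    then have b: "?b > 0" using Re_q_nonneg[OF y] by simp
    \<comment> \<open>The scalar \<open>- cnj ?g / ?b\<close> minimizes the quadratic expression in
      \<open>expand\<close>.\<close>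
    have "- (cnj ?g / of_real ?b) * ?g = of_real (- (cmod ?g)\<^sup>2 / ?b)"
      by (simp add: complex_norm_square mult_ac del: of_real_power)
    then have 1: "Re (- (cnj ?g / of_real ?b) * ?g) = - (cmod ?g)\<^sup>2 / ?b"
      by (simp only: Re_complex_of_real)
    have 2: "(cmod (- (cnj ?g / of_real ?b)))\<^sup>2 * ?b = (cmod ?g)\<^sup>2 / ?b"
      using b by (simp add: norm_divide power_divide power2_eq_square)
    have "0 \<le> ?a - (cmod ?g)\<^sup>2 / ?b"
      using expand[of "- (cnj ?g / of_real ?b)"] unfolding 1 2 by simp
    then show ?thesis using b by (simp add: field_simps)
  qed
  then show ?thesis
    by (simp add: snorm_def real_le_rsqrt flip: real_sqrt_mult)
qed

lemma snorm_triangle: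
  assumes x: "x \<in> V" and y: "y \<in> V"
  shows "snorm (add x y) \<le> snorm x + snorm y"
proof (rule power2_le_imp_le)
  have "(snorm (add x y))\<^sup>2 = (snorm x)\<^sup>2 + (snorm y)\<^sup>2 + 2 * Re (q x y)"
    using x y by (simp add: snorm_power2 q_cnj[OF x y])
  also have "\<dots> \<le> (snorm x + snorm y)\<^sup>2"
    using Cauchy_Schwarz[OF x y] complex_Re_le_cmod[of "q x y"] by (simp add: power2_sum)
  finally show "(snorm (add x y))\<^sup>2 \<le> (snorm x + snorm y)\<^sup>2" .
qed (use x y in auto)

lemma snorm_scale: "x \<in> V \<Longrightarrow> snorm (scale c x) = cmod c * snorm x"
proof -
  assume x: "x \<in> V"
  have "q (scale c x) (scale c x) = of_real ((cmod c)\<^sup>2) * q x x"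
    using x by (simp add: complex_norm_square flip: of_real_power)
  then show ?thesis
    by (simp add: snorm_def real_sqrt_mult)
qed

lemma snorm_diff_commute: "\<lbrakk>x \<in> V; y \<in> V\<rbrakk> \<Longrightarrow> snorm (diff x y) = snorm (diff y x)"
  by (rule snorm_eqI) (auto simp: algebra_simps)

lemma snorm_diff_triangle:
  assumes "x \<in> V" "y \<in> V" "z \<in> V"
  shows "snorm (diff x z) \<le> snorm (diff x y) + snorm (diff y z)"
proof -
  have "snorm (diff x z) = snorm (add (diff x y) (diff y z))"
    using assms by (intro snorm_eqI) (auto simp: algebra_simps)
  then show ?thesis using assms snorm_triangle by simp
qed

lemma snorm_le_diff:
  assumes "x \<in> V" "y \<in> V"
  shows "snorm x \<le> snorm (diff x y) + snorm y"
proof -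
  have "snorm x = snorm (add (diff x y) y)"
    using assms by (intro snorm_eqI) (auto simp: algebra_simps)
  then show ?thesis using assms snorm_triangle by simp
qed

section \<open>Cauchy sequences for the semi-norm\<close>

lemma cauchyD:
  "\<lbrakk>cauchy v; e > 0\<rbrakk> \<Longrightarrow> \<exists>N. \<forall>m\<ge>N. \<forall>n\<ge>N. snorm (diff (v m) (v n)) < e"
  by (simp add: cauchy_def)

lemma cauchy_bounded:
  assumes "cauchy v" and V: "\<And>n. v n \<in> V"
  shows "\<exists>M>0. \<forall>n. snorm (v n) \<le> M"
proof -
  obtain N where N: "\<forall>m\<ge>N. \<forall>n\<ge>N. snorm (diff (v m) (v n)) < 1"
    using cauchyD[OF assms(1), of 1] by auto
  let ?M = "1 + (\<Sum>i\<le>N. snorm (v i))"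
  have S: "snorm (v i) \<le> (\<Sum>i\<le>N. snorm (v i))" if "i \<le> N" for i
    using that by (intro member_le_sum) (auto simp: V)
  have "snorm (v n) \<le> ?M" for n
  proof (cases "n \<le> N")
    case True
    then show ?thesis using S[of n] by simp
  next
    case False
    then have "snorm (diff (v n) (v N)) < 1" using N by auto
    then show ?thesis
      using S[of N] snorm_le_diff[of "v n" "v N"] V by force
  qed
  moreover have "?M > 0"
    by (intro add_pos_nonneg sum_nonneg) (auto simp: V)
  ultimately show ?thesis by blast
qed

lemma cauchy_add:
  assumes "cauchy v" "cauchy w" and V: "\<And>n. v n \<in> V" "\<And>n. w n \<in> V"
  shows "cauchy (\<lambda>n. add (v n) (w n))"
  unfolding cauchy_def
proof (intro allI impI)
  fix e :: real assume "e > 0"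
  then obtain N1 N2 where N: "\<forall>m\<ge>N1. \<forall>n\<ge>N1. snorm (diff (v m) (v n)) < e/2"
     "\<forall>m\<ge>N2. \<forall>n\<ge>N2. snorm (diff (w m) (w n)) < e/2"
    using cauchyD[OF assms(1), of "e/2"] cauchyD[OF assms(2), of "e/2"] by auto
  have "snorm (diff (add (v m) (w m)) (add (v n) (w n))) < e" if "m \<ge> max N1 N2" "n \<ge> max N1 N2" for m n
  proof -
    have "snorm (diff (add (v m) (w m)) (add (v n) (w n)))
        = snorm (add (diff (v m) (v n)) (diff (w m) (w n)))"
      by (intro snorm_eqI) (auto simp: V algebra_simps)
    also have "\<dots> \<le> snorm (diff (v m) (v n)) + snorm (diff (w m) (w n))"
      by (intro snorm_triangle) (auto simp: V)
    also have "\<dots> < e" using N(1)[rule_format, of m n] N(2)[rule_format, of m n] that by auto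
    finally show ?thesis .
  qed
  then show "\<exists>N. \<forall>m\<ge>N. \<forall>n\<ge>N. snorm (diff (add (v m) (w m)) (add (v n) (w n))) < e" by blast
qed

lemma cauchy_scale:
  assumes "cauchy v" and V: "\<And>n. v n \<in> V"
  shows "cauchy (\<lambda>n. scale c (v n))"
  unfolding cauchy_def
proof (intro allI impI)
  fix e :: real assume "e > 0"
  \<comment> \<open>The added 1 keeps the denominator positive when \<open>c = 0\<close>.\<close>
  then have "e / (cmod c + 1) > 0" by (simp add: add_nonneg_pos)
  then obtain N where N: "\<forall>m\<ge>N. \<forall>n\<ge>N. snorm (diff (v m) (v n)) < e / (cmod c + 1)"
    using cauchyD[OF assms(1)] by blast
  have "snorm (diff (scale c (v m)) (scale c (v n))) < e" if "m \<ge> N" "n \<ge> N" for m n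
  proof -
    have "snorm (diff (scale c (v m)) (scale c (v n))) = snorm (scale c (diff (v m) (v n)))"
      by (intro snorm_eqI) (auto simp: V algebra_simps)
    also have "\<dots> = cmod c * snorm (diff (v m) (v n))"
      by (simp add: V snorm_scale)
    also have "\<dots> \<le> (cmod c + 1) * snorm (diff (v m) (v n))"
      by (intro mult_right_mono) (auto simp: V)
    also have "\<dots> < e"
      using N[rule_format, of m n] that by (simp add: pos_less_divide_eq add_nonneg_pos mult.commute)
    finally show ?thesis .
  qed
  then show "\<exists>N. \<forall>m\<ge>N. \<forall>n\<ge>N. snorm (diff (scale c (v m)) (scale c (v n))) < e" by blast
qed

lemma cauchy_diff:
  assumes "cauchy v" "cauchy w" and V: "\<And>n. v n \<in> V" "\<And>n. w n \<in> V"
  shows "cauchy (\<lambda>n. diff (v n) (w n))"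
  unfolding diff_def by (intro cauchy_add cauchy_scale assms scale_closed)

end


section \<open>Hilbert spaces over a carrier\<close>

lemma complex_field_simps [simp]:
  "carrier complex_field = UNIV" "\<zero>\<^bsub>complex_field\<^esub> = 0" "\<one>\<^bsub>complex_field\<^esub> = 1"
  "x \<oplus>\<^bsub>complex_field\<^esub> y = x + y" "x \<otimes>\<^bsub>complex_field\<^esub> y = x * y"
  by (simp_all add: ring_of_type_algebra_def)

lemma complex_field_a_inv [simp]: "\<ominus>\<^bsub>complex_field\<^esub> x = - x"
proof -
  interpret C: cring complex_field by (rule cring_from_type_algebra)
  show ?thesis by (rule C.minus_equality) auto
qed

lemma complex_moduleI:
  fixes M (structure)
  assumes add: "\<And>x y. \<lbrakk>x \<in> carrier M; y \<in> carrier M\<rbrakk> \<Longrightarrow> x \<oplus> y \<in> carrier M"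
      "\<zero> \<in> carrier M"
      "\<And>x y z. \<lbrakk>x \<in> carrier M; y \<in> carrier M; z \<in> carrier M\<rbrakk> \<Longrightarrow> (x \<oplus> y) \<oplus> z = x \<oplus> (y \<oplus> z)"
      "\<And>x y. \<lbrakk>x \<in> carrier M; y \<in> carrier M\<rbrakk> \<Longrightarrow> x \<oplus> y = y \<oplus> x"
      "\<And>x. x \<in> carrier M \<Longrightarrow> \<zero> \<oplus> x = x"
    and neg: "\<And>x. x \<in> carrier M \<Longrightarrow> (-1) \<odot> x \<oplus> x = \<zero>"
    and smult_closed: "\<And>a x. x \<in> carrier M \<Longrightarrow> a \<odot> x \<in> carrier M"
    and smult: "\<And>a b x. x \<in> carrier M \<Longrightarrow> (a + b) \<odot> x = a \<odot> x \<oplus> b \<odot> x"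
      "\<And>a x y. \<lbrakk>x \<in> carrier M; y \<in> carrier M\<rbrakk> \<Longrightarrow> a \<odot> (x \<oplus> y) = a \<odot> x \<oplus> a \<odot> y"
      "\<And>a b x. x \<in> carrier M \<Longrightarrow> (a * b) \<odot> x = a \<odot> (b \<odot> x)"
      "\<And>x. x \<in> carrier M \<Longrightarrow> 1 \<odot> x = x"
  shows "module complex_field M"
proof (rule moduleI)
  show "abelian_group M"
    by (rule abelian_groupI; (rule add)?) (use neg smult_closed in blast)+
qed (simp_all add: cring_from_type_algebra smult_closed smult)

lemma minus_eq_smult:
  fixes M (structure)
  assumes "module complex_field M" "x \<in> carrier M" "y \<in> carrier M"
  shows "x \<ominus> y = x \<oplus> (-1) \<odot> y"
  using assms module.smult_l_minus[of complex_field M 1 y] module.smult_one[of complex_field M y]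
  by (simp add: a_minus_def)

context hilbert_space
begin

sublocale semi_inner_space "carrier H" "add H" "smult H" "inner_prod H"
proof
  fix x y assume "x \<in> carrier H" "y \<in> carrier H"
  then show "inner_prod H y x = cnj (inner_prod H x y)" by (rule inner_cnj)
qed (auto simp: inner_add_left inner_smult_left inner_nonneg)

lemma snorm_eq_hnorm: "snorm = hnorm H"
  by (simp add: fun_eq_iff snorm_def hnorm_def)

lemma diff_eq_minus: "\<lbrakk>x \<in> carrier H; y \<in> carrier H\<rbrakk> \<Longrightarrow> diff x y = x \<ominus> y"
  by (simp add: diff_def minus_eq_smult[OF module_axioms])

lemma inner_zero_left [simp]: "x \<in> carrier H \<Longrightarrow> inner_prod H \<zero> x = 0"
  using q_scale_left[of x x 0] smult_l_null[of x] by (metis complex_field_simps(2) mult_zero_left)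

lemma inner_zero_right [simp]: "x \<in> carrier H \<Longrightarrow> inner_prod H x \<zero> = 0"
  using inner_zero_left[of x] q_cnj[of \<zero> x] by simp

lemma eq_zeroI: "\<lbrakk>x \<in> carrier H; \<And>y. y \<in> carrier H \<Longrightarrow> inner_prod H x y = 0\<rbrakk> \<Longrightarrow> x = \<zero>"
  by (simp add: inner_definite)

lemma inner_eqI:
  assumes "x \<in> carrier H" "y \<in> carrier H"
    and "\<And>z. z \<in> carrier H \<Longrightarrow> inner_prod H x z = inner_prod H y z"
  shows "x = y"
proof -
  have "x \<ominus> y = \<zero>"
    by (rule eq_zeroI) (use assms in \<open>auto simp flip: diff_eq_minus\<close>)
  then show ?thesis using assms(1,2)
    by (metis M.add.inv_closed M.add.inv_inv M.minus_equality a_minus_def)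
qed

lemma cauchy_convergent:
  assumes "cauchy \<xi>" and "\<And>n. \<xi> n \<in> carrier H"
  obtains x where "x \<in> carrier H" "(\<lambda>n. snorm (diff (\<xi> n) x)) \<longlonglongrightarrow> 0"
proof -
  have "\<exists>x\<in>carrier H. (\<lambda>n. hnorm H (\<xi> n \<ominus> x)) \<longlonglongrightarrow> 0"
  proof (rule complete)
    show "\<exists>N. \<forall>m\<ge>N. \<forall>n\<ge>N. hnorm H (\<xi> m \<ominus> \<xi> n) < e" if "e > 0" for e
      using cauchyD[OF assms(1) that] assms(2) by (simp add: snorm_eq_hnorm diff_eq_minus)
  qed (rule assms(2))
  then obtain x where "x \<in> carrier H" "(\<lambda>n. hnorm H (\<xi> n \<ominus> x)) \<longlonglongrightarrow> 0" by blast
  then show thesis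
    using that[of x] assms(2) by (simp add: snorm_eq_hnorm diff_eq_minus)
qed

lemma inner_tendsto:
  assumes x: "x \<in> carrier H" "\<And>n. \<xi> n \<in> carrier H" "(\<lambda>n. snorm (diff (\<xi> n) x)) \<longlonglongrightarrow> 0"
    and y: "y \<in> carrier H"
  shows "(\<lambda>n. inner_prod H (\<xi> n) y) \<longlonglongrightarrow> inner_prod H x y"
proof (rule LIM_zero_cancel)
  have "norm (inner_prod H (\<xi> n) y - inner_prod H x y) \<le> snorm (diff (\<xi> n) x) * snorm y" for n
    using Cauchy_Schwarz[of "diff (\<xi> n) x" y] x(1,2) y by simp
  then show "(\<lambda>n. inner_prod H (\<xi> n) y - inner_prod H x y) \<longlonglongrightarrow> 0"
    by (intro Lim_null_comparison[OF always_eventually tendsto_mult_left_zero[OF x(3), of "snorm y"]]) simp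
qed

end


section \<open>Completion of a semi-inner product space\<close>

text \<open>A vector of the completion is represented by the conjugate-linear functional that it induces on
  the space, i.e. by the pointwise limit of \<open>q (v n)\<close> for a Cauchy sequence \<open>v\<close>.\<close>

locale semi_inner_completion = semi_inner_space UNIV add scale q
  for add :: "'v \<Rightarrow> 'v \<Rightarrow> 'v" and scale q
begin

definition approx :: "(nat \<Rightarrow> 'v) \<Rightarrow> ('v \<Rightarrow> complex) \<Rightarrow> bool" where
  "approx v F \<longleftrightarrow> cauchy v \<and> (\<forall>w. (\<lambda>n. q (v n) w) \<longlonglongrightarrow> F w)"

definition limits :: "('v \<Rightarrow> complex) set" where
  "limits = {F. \<exists>v. approx v F}"

text \<open>If \<open>F\<close> represents x, then \<open>F (w n)\<close> is the inner product of x
  with \<open>w n\<close>, so this is the extension of \<open>q\<close> by continuity. The chosen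
  sequence is immaterial by \<open>limit_inner_tendsto\<close>.\<close>

definition limit_inner :: "('v \<Rightarrow> complex) \<Rightarrow> ('v \<Rightarrow> complex) \<Rightarrow> complex" where
  "limit_inner F G = lim (\<lambda>n. F ((SOME w. approx w G) n))"

definition completion :: "('v \<Rightarrow> complex) hilbert" where
  "completion = \<lparr>carrier = limits, monoid.mult = undefined, one = undefined, ring.zero = (\<lambda>w. 0),
     ring.add = (\<lambda>F G w. F w + G w), module.smult = (\<lambda>c F w. c * F w), inner_prod = limit_inner\<rparr>"

lemma completion_simps [simp]:
  "carrier completion = limits" "\<zero>\<^bsub>completion\<^esub> = (\<lambda>w. 0)"
  "F \<oplus>\<^bsub>completion\<^esub> G = (\<lambda>w. F w + G w)" "c \<odot>\<^bsub>completion\<^esub> F = (\<lambda>w. c * F w)"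
  "inner_prod completion = limit_inner"
  by (simp_all add: completion_def)

lemma limitsI: "approx v F \<Longrightarrow> F \<in> limits"
  by (auto simp: limits_def)

lemma limitsE:
  assumes "F \<in> limits"
  obtains v where "approx v F"
  using assms by (auto simp: limits_def)

lemma approx_tendsto: "approx v F \<Longrightarrow> (\<lambda>n. q (v n) w) \<longlonglongrightarrow> F w"
  by (simp add: approx_def)

lemma approx_cauchy: "approx v F \<Longrightarrow> cauchy v"
  by (simp add: approx_def)

lemma limits_add: "F \<in> limits \<Longrightarrow> F (add w z) = F w + F z"
  by (erule limitsE, rule LIMSEQ_unique[OF approx_tendsto])
    (auto intro!: tendsto_add approx_tendsto)

lemma limits_scale: "F \<in> limits \<Longrightarrow> F (scale c w) = cnj c * F w"
  by (erule limitsE, rule LIMSEQ_unique[OF approx_tendsto])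
    (auto intro!: tendsto_mult_left approx_tendsto)

lemma limits_diff: "F \<in> limits \<Longrightarrow> F (diff w z) = F w - F z"
  by (simp add: diff_def limits_add limits_scale)

lemma approx_add: "\<lbrakk>approx v F; approx w G\<rbrakk> \<Longrightarrow> approx (\<lambda>n. add (v n) (w n)) (\<lambda>x. F x + G x)"
  by (auto simp: approx_def intro!: cauchy_add tendsto_add)

lemma approx_scale: "approx v F \<Longrightarrow> approx (\<lambda>n. scale c (v n)) (\<lambda>x. c * F x)"
  by (auto simp: approx_def intro!: cauchy_scale tendsto_mult_left)

lemma approx_diff: "\<lbrakk>approx v F; approx w G\<rbrakk> \<Longrightarrow> approx (\<lambda>n. diff (v n) (w n)) (\<lambda>x. F x - G x)"
  by (auto simp: approx_def intro!: cauchy_diff tendsto_diff)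

lemma snorm_diff_self [simp]: "snorm (diff v v) = 0"
  by (simp add: snorm_def)

lemma approx_const: "approx (\<lambda>_. v) (q v)"
  by (auto simp: approx_def cauchy_def)

text \<open>The canonical map into the completion. By Cauchy-Schwarz it sends null vectors to 0, so
  the quotient is implicit.\<close>

lemma q_in_limits [simp]: "q v \<in> limits"
  by (rule limitsI[OF approx_const])

text \<open>Pointwise convergence becomes uniform on bounded sets: apply Cauchy-Schwarz to
  \<open>diff (v m) (v n)\<close> and let m tend to infinity.\<close>

lemma approx_uniform:
  assumes F: "approx v F" and e: "e > 0"
  shows "\<exists>N. \<forall>n\<ge>N. \<forall>w. cmod (F w - q (v n) w) \<le> e * snorm w"
proof -
  obtain N where N: "\<forall>m\<ge>N. \<forall>n\<ge>N. snorm (diff (v m) (v n)) < e"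
    using cauchyD[OF approx_cauchy[OF F] e] by blast
  have "cmod (F w - q (v n) w) \<le> e * snorm w" if "n \<ge> N" for n w
  proof (rule LIMSEQ_le_const2)
    show "(\<lambda>m. cmod (q (v m) w - q (v n) w)) \<longlonglongrightarrow> cmod (F w - q (v n) w)"
      by (intro tendsto_norm tendsto_diff tendsto_const approx_tendsto[OF F])
    have "cmod (q (v m) w - q (v n) w) \<le> e * snorm w" if "m \<ge> N" for m
    proof -
      have "cmod (q (v m) w - q (v n) w) \<le> snorm (diff (v m) (v n)) * snorm w"
        using Cauchy_Schwarz[of "diff (v m) (v n)" w] by simp
      also have "\<dots> \<le> e * snorm w"
        using N \<open>m \<ge> N\<close> \<open>n \<ge> N\<close> by (intro mult_right_mono) (auto intro: less_imp_le)
      finally show ?thesis .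
    qed
    then show "\<exists>M. \<forall>m\<ge>M. cmod (q (v m) w - q (v n) w) \<le> e * snorm w" by blast
  qed
  then show ?thesis by blast
qed

lemma limits_bounded:
  assumes "F \<in> limits"
  shows "\<exists>M>0. \<forall>w. cmod (F w) \<le> M * snorm w"
proof -
  obtain v where F: "approx v F" using assms by (rule limitsE)
  obtain N where N: "\<forall>n\<ge>N. \<forall>w. cmod (F w - q (v n) w) \<le> 1 * snorm w"
    using approx_uniform[OF F, of 1] by auto
  have "cmod (F w) \<le> (1 + snorm (v N)) * snorm w" for w
  proof -
    have "cmod (F w) \<le> cmod (F w - q (v N) w) + cmod (q (v N) w)"
      by (metis diff_add_cancel norm_triangle_ineq)
    also have "\<dots> \<le> 1 * snorm w + snorm (v N) * snorm w"
      using N by (intro add_mono Cauchy_Schwarz) auto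
    finally show ?thesis by (simp add: algebra_simps)
  qed
  moreover have "1 + snorm (v N) > 0" by (simp add: add_pos_nonneg)
  ultimately show ?thesis by blast
qed

lemma limits_cauchy:
  assumes "F \<in> limits" and w: "cauchy w"
  shows "Cauchy (\<lambda>n. F (w n))"
proof (rule metric_CauchyI)
  fix e :: real assume "e > 0"
  obtain M where M: "M > 0" "\<And>w. cmod (F w) \<le> M * snorm w"
    using limits_bounded[OF assms(1)] by blast
  obtain N where N: "\<forall>m\<ge>N. \<forall>n\<ge>N. snorm (diff (w m) (w n)) < e / M"
    using cauchyD[OF w, of "e / M"] \<open>e > 0\<close> M(1) by auto
  have "dist (F (w m)) (F (w n)) < e" if "m \<ge> N" "n \<ge> N" for m n
  proof -
    have "dist (F (w m)) (F (w n)) \<le> M * snorm (diff (w m) (w n))"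
      using M(2)[of "diff (w m) (w n)"] assms(1) by (simp add: dist_norm limits_diff)
    also have "\<dots> < e" using N that M(1) by (simp add: pos_less_divide_eq mult.commute)
    finally show ?thesis .
  qed
  then show "\<exists>N. \<forall>m\<ge>N. \<forall>n\<ge>N. dist (F (w m)) (F (w n)) < e" by blast
qed

text \<open>This makes \<open>limit_inner\<close> independent of the approximating sequence. As
  \<open>z\<close> is bounded, \<open>F\<close> may be replaced by some \<open>q (v N)\<close> with
  an error of at most e/2 along \<open>z\<close>, and \<open>q (v N) (z n)\<close> tends to 0 by
  conjugate symmetry.\<close>

lemma approx_zero_vanish:
  assumes "F \<in> limits" and z: "approx z (\<lambda>w. 0)"
  shows "(\<lambda>n. F (z n)) \<longlonglongrightarrow> 0"
proof (rule LIMSEQ_I)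
  fix e :: real assume e: "e > 0"
  obtain v where F: "approx v F" using assms(1) by (rule limitsE)
  obtain M where M: "M > 0" "\<And>n. snorm (z n) \<le> M"
    using cauchy_bounded[OF approx_cauchy[OF z]] by auto
  obtain N where N: "\<And>w. cmod (F w - q (v N) w) \<le> e / (2 * M) * snorm w"
    using approx_uniform[OF F, of "e / (2 * M)"] e M(1) by auto
  have "(\<lambda>n. cnj (q (z n) (v N))) \<longlonglongrightarrow> cnj 0"
    by (intro tendsto_cnj approx_tendsto[OF z])
  then have "(\<lambda>n. q (v N) (z n)) \<longlonglongrightarrow> 0"
    by (simp flip: q_cnj)
  then obtain n0 where n0: "\<And>n. n \<ge> n0 \<Longrightarrow> cmod (q (v N) (z n)) < e / 2"
    using LIMSEQ_D[of _ 0 "e / 2"] e by force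
  have "cmod (F (z n)) < e" if "n \<ge> n0" for n
  proof -
    have "cmod (F (z n)) \<le> cmod (F (z n) - q (v N) (z n)) + cmod (q (v N) (z n))"
      by (metis diff_add_cancel norm_triangle_ineq)
    also have "cmod (F (z n) - q (v N) (z n)) \<le> e / (2 * M) * M"
      using e M by (intro order_trans[OF N] mult_left_mono) auto
    finally show ?thesis using n0[OF that] M(1) by simp
  qed
  then show "\<exists>n0. \<forall>n\<ge>n0. cmod (F (z n) - 0) < e" by auto
qed

section \<open>The inner product of limit functionals\<close>

lemma limit_inner_tendsto:
  assumes F: "F \<in> limits" and w: "approx w G"
  shows "(\<lambda>n. F (w n)) \<longlonglongrightarrow> limit_inner F G"
proof -
  define w' where "w' = (SOME w. approx w G)"
  have w': "approx w' G" unfolding w'_def using w by (rule someI[of "\<lambda>w. approx w G"])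
  have lim: "(\<lambda>n. F (w' n)) \<longlonglongrightarrow> limit_inner F G"
    using limits_cauchy[OF F approx_cauchy[OF w']]
    by (simp add: limit_inner_def w'_def Cauchy_convergent_iff convergent_LIMSEQ_iff)
  have "(\<lambda>n. F (diff (w n) (w' n))) \<longlonglongrightarrow> 0"
    using approx_diff[OF w w'] by (intro approx_zero_vanish F) simp
  then have "(\<lambda>n. F (w n) - F (w' n) + F (w' n)) \<longlonglongrightarrow> 0 + limit_inner F G"
    using lim by (intro tendsto_add) (simp_all add: limits_diff F)
  then show ?thesis by simp
qed

lemma limit_inner_q [simp]: "F \<in> limits \<Longrightarrow> limit_inner F (q w) = F w"
  using limit_inner_tendsto[OF _ approx_const, of F w] by (simp add: LIMSEQ_const_iff)

text \<open>The iterated limit may be taken along the diagonal, because \<open>q (v n)\<close>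
  approximates \<open>F\<close> uniformly on the bounded sequence \<open>w\<close>.\<close>

lemma limit_inner_tendsto_q:
  assumes v: "approx v F" and w: "approx w G"
  shows "(\<lambda>n. q (v n) (w n)) \<longlonglongrightarrow> limit_inner F G"
proof -
  obtain M where M: "M > 0" "\<And>n. snorm (w n) \<le> M"
    using cauchy_bounded[OF approx_cauchy[OF w]] by auto
  have "(\<lambda>n. F (w n) - q (v n) (w n)) \<longlonglongrightarrow> 0"
  proof (rule LIMSEQ_I)
    fix e :: real assume e: "e > 0"
    obtain N where N: "\<And>n w. n \<ge> N \<Longrightarrow> cmod (F w - q (v n) w) \<le> e / (2 * M) * snorm w"
      using approx_uniform[OF v, of "e / (2 * M)"] e M(1) by auto
    have "cmod (F (w n) - q (v n) (w n)) < e" if "n \<ge> N" for n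
    proof -
      have "cmod (F (w n) - q (v n) (w n)) \<le> e / (2 * M) * M"
        using e M that by (intro order_trans[OF N] mult_left_mono) auto
      then show ?thesis using e M(1) by simp
    qed
    then show "\<exists>N. \<forall>n\<ge>N. cmod (F (w n) - q (v n) (w n) - 0) < e" by auto
  qed
  from tendsto_diff[OF limit_inner_tendsto[OF limitsI[OF v] w] this] show ?thesis by simp
qed

lemma limit_inner_cnj:
  assumes "F \<in> limits" "G \<in> limits"
  shows "limit_inner G F = cnj (limit_inner F G)"
proof -
  obtain v w where v: "approx v F" and w: "approx w G"
    using assms by (elim limitsE)
  have "(\<lambda>n. cnj (q (v n) (w n))) \<longlonglongrightarrow> cnj (limit_inner F G)"
    by (intro tendsto_cnj limit_inner_tendsto_q v w)
  then have "(\<lambda>n. q (w n) (v n)) \<longlonglongrightarrow> cnj (limit_inner F G)"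
    by (simp flip: q_cnj)
  then show ?thesis
    by (rule LIMSEQ_unique[OF limit_inner_tendsto_q[OF w v]])
qed

text \<open>Each axiom is a limit of the same axiom for \<open>q\<close>. The functionals thereby
  get their own norm, differences and Cauchy sequences.\<close>

sublocale limits: semi_inner_space limits "\<lambda>F G w. F w + G w" "\<lambda>c F w. c * F w" limit_inner
proof
  fix F G K :: "'v \<Rightarrow> complex" assume F: "F \<in> limits" and G: "G \<in> limits"
  obtain v where v: "approx v F" using F by (rule limitsE)
  obtain w where w: "approx w G" using G by (rule limitsE)
  show FG: "(\<lambda>w. F w + G w) \<in> limits"
    by (rule limitsI[OF approx_add[OF v w]])
  show "limit_inner G F = cnj (limit_inner F G)"
    using F G by (rule limit_inner_cnj)
  show "limit_inner (\<lambda>w. F w + G w) K = limit_inner F K + limit_inner G K" if K: "K \<in> limits"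
  proof -
    obtain z where z: "approx z K" using K by (rule limitsE)
    show ?thesis
      using limit_inner_tendsto[OF FG z]
        tendsto_add[OF limit_inner_tendsto[OF F z] limit_inner_tendsto[OF G z]]
      by (rule LIMSEQ_unique)
  qed
next
  fix F :: "'v \<Rightarrow> complex" and c assume F: "F \<in> limits"
  obtain v where v: "approx v F" using F by (rule limitsE)
  show cF: "(\<lambda>w. c * F w) \<in> limits"
    by (rule limitsI[OF approx_scale[OF v]])
  show "limit_inner (\<lambda>w. c * F w) K = c * limit_inner F K" if K: "K \<in> limits" for K
  proof -
    obtain z where z: "approx z K" using K by (rule limitsE)
    show ?thesis
      using limit_inner_tendsto[OF cF z] tendsto_mult_left[OF limit_inner_tendsto[OF F z]]
      by (rule LIMSEQ_unique)
  qed
  show "limit_inner F F \<in> \<real>\<^sub>\<ge>\<^sub>0"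
    using closed_nonneg_Reals_complex _ limit_inner_tendsto_q[OF v v]
    by (rule closed_sequentially) (simp add: q_nonneg)
qed

lemma q_diff_fun: "q (diff v w) = (\<lambda>z. q v z - q w z)"
  by (simp add: fun_eq_iff)

lemma limits_snorm_q [simp]: "limits.snorm (q v) = snorm v"
  by (simp add: limits.snorm_def snorm_def)

lemma limits_diff_eq: "limits.diff F G = (\<lambda>w. F w - G w)"
  by (simp add: limits.diff_def)

text \<open>Density of the original space. With D the difference of \<open>F\<close> and
  \<open>q (v n)\<close>, the squared norm of D is the limit of \<open>D (diff (v m) (v n))\<close>,
  which \<open>approx_uniform\<close> bounds by e/2 times a sequence converging to the norm of D;
  one factor cancels.\<close>

lemma approx_norm:
  assumes v: "approx v F"
  shows "(\<lambda>n. limits.snorm (limits.diff (q (v n)) F)) \<longlonglongrightarrow> 0"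
proof (rule LIMSEQ_I)
  fix e :: real assume e: "e > 0"
  obtain N where N: "\<And>n w. n \<ge> N \<Longrightarrow> cmod (F w - q (v n) w) \<le> e / 2 * snorm w"
    using approx_uniform[OF v, of "e / 2"] e by auto
  have "limits.snorm (limits.diff (q (v n)) F) < e" if "n \<ge> N" for n
  proof -
    let ?D = "limits.diff F (q (v n))" and ?s = "limits.snorm (limits.diff F (q (v n)))"
    have D: "?D \<in> limits"
      by (intro limits.diff_closed limitsI[OF v] q_in_limits)
    have Da: "approx (\<lambda>m. diff (v m) (v n)) ?D"
      unfolding limits_diff_eq by (intro approx_diff v approx_const)
    have "cmod (limit_inner ?D ?D) \<le> e / 2 * ?s"
    proof (rule LIMSEQ_le)
      show "(\<lambda>m. cmod (?D (diff (v m) (v n)))) \<longlonglongrightarrow> cmod (limit_inner ?D ?D)"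
        by (intro tendsto_norm limit_inner_tendsto D Da)
      have "(\<lambda>m. snorm (diff (v m) (v n))) \<longlonglongrightarrow> ?s"
        unfolding snorm_def limits.snorm_def
        by (intro tendsto_real_sqrt tendsto_Re limit_inner_tendsto_q Da)
      then show "(\<lambda>m. e / 2 * snorm (diff (v m) (v n))) \<longlonglongrightarrow> e / 2 * ?s"
        by (rule tendsto_mult_left)
      show "\<exists>M. \<forall>m\<ge>M. cmod (?D (diff (v m) (v n))) \<le> e / 2 * snorm (diff (v m) (v n))"
        using N[OF that] unfolding limits_diff_eq by blast
    qed
    then have "?s\<^sup>2 \<le> e / 2 * ?s"
      using limits.q_self[OF D] limits.snorm_nonneg[OF D] by (simp add: norm_power)
    then have "?s \<le> e / 2"
      using e limits.snorm_nonneg[OF D] by (cases "?s = 0") (auto simp: power2_eq_square)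
    then show ?thesis
      using e limits.snorm_diff_commute[OF limitsI[OF v] q_in_limits] by simp
  qed
  moreover have "0 \<le> limits.snorm (limits.diff (q (v n)) F)" for n
    by (intro limits.snorm_nonneg limits.diff_closed limitsI[OF v] q_in_limits)
  ultimately show "\<exists>N. \<forall>n\<ge>N. norm (limits.snorm (limits.diff (q (v n)) F) - 0) < e"
    by auto
qed

section \<open>The completion is a Hilbert space\<close>

lemma module_completion: "module complex_field completion"
proof (rule complex_moduleI)
  \<comment> \<open>No zero vector is distinguished in the original space, so 0 is obtained as the
    zero multiple of an arbitrary functional.\<close>
  show "\<zero>\<^bsub>completion\<^esub> \<in> carrier completion"
    using limits.scale_closed[of "q undefined" 0] by simp
qed (auto simp: algebra_simps)

lemma completion_minus:
  "\<lbrakk>F \<in> limits; G \<in> limits\<rbrakk> \<Longrightarrow> F \<ominus>\<^bsub>completion\<^esub> G = limits.diff F G"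
  by (simp add: minus_eq_smult[OF module_completion] limits.diff_def)

lemma hnorm_completion: "hnorm completion F = limits.snorm F"
  by (simp add: hnorm_def limits.snorm_def)

text \<open>By density, each \<open>\<xi> n\<close> has an original vector \<open>w n\<close> within
  1/(n + 1). The sequence \<open>w\<close> is again Cauchy, and the functional that it defines is
  the limit of \<open>\<xi>\<close>.\<close>

lemma limits_complete:
  assumes \<xi>: "\<And>n. \<xi> n \<in> limits" and cauchy: "limits.cauchy \<xi>"
  obtains F where "F \<in> limits" "(\<lambda>n. limits.snorm (limits.diff (\<xi> n) F)) \<longlonglongrightarrow> 0"
proof -
  have "\<exists>w. limits.snorm (limits.diff (q w) (\<xi> n)) < inverse (real (Suc n))" for n
  proof -
    obtain v where "approx v (\<xi> n)" using \<xi> by (rule limitsE)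
    from LIMSEQ_D[OF approx_norm[OF this], of "inverse (real (Suc n))"]
    show ?thesis by (force simp: abs_less_iff)
  qed
  then obtain w where w: "\<And>n. limits.snorm (limits.diff (q (w n)) (\<xi> n)) < inverse (real (Suc n))"
    by metis
  have wlim: "(\<lambda>n. limits.snorm (limits.diff (q (w n)) (\<xi> n))) \<longlonglongrightarrow> 0"
  proof (rule Lim_null_comparison[OF always_eventually LIMSEQ_inverse_real_of_nat], rule allI)
    show "norm (limits.snorm (limits.diff (q (w n)) (\<xi> n))) \<le> inverse (real (Suc n))" for n
      using w[of n] limits.snorm_nonneg[of "limits.diff (q (w n)) (\<xi> n)"] \<xi> by simp
  qed
  have cw: "cauchy w"
    unfolding cauchy_def
  proof (intro allI impI)
    fix e :: real assume e: "e > 0"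
    obtain N1 where N1: "\<And>m n. m \<ge> N1 \<Longrightarrow> n \<ge> N1 \<Longrightarrow> limits.snorm (limits.diff (\<xi> m) (\<xi> n)) < e / 3"
      using limits.cauchyD[OF cauchy, of "e / 3"] e by auto
    obtain N2 where N2: "\<And>n. n \<ge> N2 \<Longrightarrow> limits.snorm (limits.diff (q (w n)) (\<xi> n)) < e / 3"
      using LIMSEQ_D[OF wlim, of "e / 3"] e by force
    have "snorm (diff (w m) (w n)) < e" if "m \<ge> max N1 N2" "n \<ge> max N1 N2" for m n
    proof -
      have "snorm (diff (w m) (w n)) = limits.snorm (limits.diff (q (w m)) (q (w n)))"
        by (simp add: limits_diff_eq flip: q_diff_fun)
      also have "\<dots> \<le> limits.snorm (limits.diff (q (w m)) (\<xi> m)) + limits.snorm (limits.diff (\<xi> m) (q (w n)))"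
        by (intro limits.snorm_diff_triangle \<xi> q_in_limits)
      also have "limits.snorm (limits.diff (\<xi> m) (q (w n)))
          \<le> limits.snorm (limits.diff (\<xi> m) (\<xi> n)) + limits.snorm (limits.diff (\<xi> n) (q (w n)))"
        by (intro limits.snorm_diff_triangle \<xi> q_in_limits)
      also have "limits.snorm (limits.diff (\<xi> n) (q (w n))) = limits.snorm (limits.diff (q (w n)) (\<xi> n))"
        by (intro limits.snorm_diff_commute \<xi> q_in_limits)
      finally show ?thesis
        using N1[of m n] N2[of m] N2[of n] that by simp
    qed
    then show "\<exists>N. \<forall>m\<ge>N. \<forall>n\<ge>N. snorm (diff (w m) (w n)) < e" by blast
  qed
  have "\<exists>L. (\<lambda>n. q (w n) z) \<longlonglongrightarrow> L" for z
  proof -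
    have "(\<lambda>n. q (w n) z) = (\<lambda>n. cnj (q z (w n)))"
      by (simp flip: q_cnj)
    moreover have "convergent (\<lambda>n. q z (w n))"
      using limits_cauchy[OF q_in_limits cw] by (simp add: Cauchy_convergent_iff)
    ultimately show ?thesis
      by (metis convergent_def tendsto_cnj)
  qed
  then obtain F where F: "approx w F"
    using cw unfolding approx_def by metis
  show thesis
  proof (rule that[OF limitsI[OF F]])
    show "(\<lambda>n. limits.snorm (limits.diff (\<xi> n) F)) \<longlonglongrightarrow> 0"
    proof (rule Lim_null_comparison[OF always_eventually], rule allI)
      show "norm (limits.snorm (limits.diff (\<xi> n) F))
          \<le> limits.snorm (limits.diff (q (w n)) (\<xi> n)) + limits.snorm (limits.diff (q (w n)) F)" for n
        using limits.snorm_diff_triangle[OF \<xi> q_in_limits limitsI[OF F], of n "w n"]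
          limits.snorm_diff_commute[OF \<xi> q_in_limits, of n "w n"]
          limits.snorm_nonneg[OF limits.diff_closed[OF \<xi> limitsI[OF F]], of n] by simp
      show "(\<lambda>n. limits.snorm (limits.diff (q (w n)) (\<xi> n)) + limits.snorm (limits.diff (q (w n)) F)) \<longlonglongrightarrow> 0"
        using tendsto_add[OF wlim approx_norm[OF F]] by simp
    qed
  qed
qed

theorem hilbert_space_completion: "hilbert_space completion"
proof (intro hilbert_space.intro module_completion hilbert_space_axioms.intro)
  fix F assume F: "F \<in> carrier completion" and 0: "inner_prod completion F F = 0"
  \<comment> \<open>\<open>F w\<close> is the inner product of \<open>F\<close> with
    \<open>q w\<close>, so a functional of norm 0 vanishes at every point.\<close>
  have "F w = 0" for w
  proof -
    have "cmod (F w) \<le> limits.snorm F * limits.snorm (q w)"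
      using limits.Cauchy_Schwarz[of F "q w"] F by simp
    then show ?thesis using 0 by (simp add: limits.snorm_def)
  qed
  then show "F = \<zero>\<^bsub>completion\<^esub>" by auto
next
  fix \<xi> :: "nat \<Rightarrow> 'v \<Rightarrow> complex"
  assume \<xi>: "\<And>n. \<xi> n \<in> carrier completion"
    and cauchy: "\<And>e. e > 0 \<Longrightarrow> \<exists>N. \<forall>m\<ge>N. \<forall>n\<ge>N. hnorm completion (\<xi> m \<ominus>\<^bsub>completion\<^esub> \<xi> n) < e"
  have "limits.cauchy \<xi>"
    using cauchy \<xi> by (simp add: limits.cauchy_def hnorm_completion completion_minus)
  then obtain F where "F \<in> limits" "(\<lambda>n. limits.snorm (limits.diff (\<xi> n) F)) \<longlonglongrightarrow> 0"
    using limits_complete \<xi> by auto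
  then show "\<exists>F\<in>carrier completion. (\<lambda>n. hnorm completion (\<xi> n \<ominus>\<^bsub>completion\<^esub> F)) \<longlonglongrightarrow> 0"
    using \<xi> by (auto simp: hnorm_completion completion_minus)
qed (auto simp: limits.q_nonneg intro: limit_inner_cnj simp del: complex_nonneg_Reals_iff)

end


section \<open>Partial representations are positive definite\<close>

text \<open>The sum of the \<open>x j\<close> matters only through its inner products, so it is
  characterized by these, with all sums taken among complex numbers.\<close>

lemma (in hilbert_space) inner_sum_exists:
  fixes n :: nat
  assumes "\<And>j. j < n \<Longrightarrow> x j \<in> carrier H"
  shows "\<exists>s\<in>carrier H. \<forall>y\<in>carrier H. inner_prod H s y = (\<Sum>j<n. inner_prod H (x j) y)"
  using assms
proof (induction n)
  case 0
  show ?case by (intro bexI[of _ \<zero>]) auto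
next
  case (Suc n)
  then obtain s where "s \<in> carrier H" "\<forall>y\<in>carrier H. inner_prod H s y = (\<Sum>j<n. inner_prod H (x j) y)"
    by auto
  then show ?case
    using Suc.prems by (intro bexI[of _ "s \<oplus> x n"]) auto
qed

text \<open>The double sum is the squared norm of the sum of the \<open>x j\<close>.\<close>

lemma (in hilbert_space) gram_sum_nonneg:
  fixes n :: nat
  assumes "\<And>j. j < n \<Longrightarrow> x j \<in> carrier H"
  shows "(\<Sum>i<n. \<Sum>j<n. inner_prod H (x j) (x i)) \<in> \<real>\<^sub>\<ge>\<^sub>0"
proof -
  obtain s where s: "s \<in> carrier H" "\<And>y. y \<in> carrier H \<Longrightarrow> inner_prod H s y = (\<Sum>j<n. inner_prod H (x j) y)"
    using inner_sum_exists[of n x] assms by blast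
  have "(\<Sum>i<n. \<Sum>j<n. inner_prod H (x j) (x i)) = (\<Sum>i<n. inner_prod H s (x i))"
    using s assms by simp
  also have "\<dots> = (\<Sum>i<n. cnj (inner_prod H (x i) s))"
    using s assms by (intro sum.cong refl q_cnj) auto
  also have "\<dots> = cnj (inner_prod H s s)"
    using s by simp
  also have "\<dots> = inner_prod H s s"
    using q_cnj[OF s(1) s(1)] by simp
  finally show ?thesis using q_nonneg[OF s(1)] by simp
qed

locale partial_rep = G: group G + H: hilbert_space H
  for G :: "'g monoid" and H :: "'h hilbert" +
  fixes u :: "'g \<Rightarrow> 'h \<Rightarrow> 'h"
  assumes rep: "partial_representation G H u"
begin

section \<open>Partial isometries and their products\<close>

lemma u_linear: "t \<in> carrier G \<Longrightarrow> linear_map H H (u t)"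
  using rep by (auto simp: partial_representation_def bounded_operator_def)

lemma u_closed [simp]: "\<lbrakk>t \<in> carrier G; x \<in> carrier H\<rbrakk> \<Longrightarrow> u t x \<in> carrier H"
  using u_linear by (auto simp: linear_map_def)

lemma u_add [simp]:
  "\<lbrakk>t \<in> carrier G; x \<in> carrier H; y \<in> carrier H\<rbrakk> \<Longrightarrow> u t (x \<oplus>\<^bsub>H\<^esub> y) = u t x \<oplus>\<^bsub>H\<^esub> u t y"
  using u_linear by (auto simp: linear_map_def)

lemma u_smult [simp]:
  "\<lbrakk>t \<in> carrier G; x \<in> carrier H\<rbrakk> \<Longrightarrow> u t (c \<odot>\<^bsub>H\<^esub> x) = c \<odot>\<^bsub>H\<^esub> u t x"
  using u_linear by (auto simp: linear_map_def)

lemma u_diff [simp]: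
  "\<lbrakk>t \<in> carrier G; x \<in> carrier H; y \<in> carrier H\<rbrakk> \<Longrightarrow> u t (H.diff x y) = H.diff (u t x) (u t y)"
  by (simp add: H.diff_def)

lemma u_one [simp]: "x \<in> carrier H \<Longrightarrow> u \<one>\<^bsub>G\<^esub> x = x"
  using rep by (auto simp: partial_representation_def)

lemma u_adjoint:
  "\<lbrakk>t \<in> carrier G; x \<in> carrier H; y \<in> carrier H\<rbrakk>
    \<Longrightarrow> inner_prod H (u t x) y = inner_prod H x (u (inv\<^bsub>G\<^esub> t) y)"
  using rep by (auto simp: partial_representation_def is_adjoint_def)

lemma u_mult:
  "\<lbrakk>s \<in> carrier G; t \<in> carrier G; x \<in> carrier H\<rbrakk>
    \<Longrightarrow> u s (u t (u (inv\<^bsub>G\<^esub> t) x)) = u (s \<otimes>\<^bsub>G\<^esub> t) (u (inv\<^bsub>G\<^esub> t) x)"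
  using rep by (auto simp: partial_representation_def)

text \<open>The third axiom for the pair \<open>t\<close>, \<open>inv t\<close>, whose product is
  the unit.\<close>

lemma u_partial_isometry:
  "\<lbrakk>t \<in> carrier G; x \<in> carrier H\<rbrakk> \<Longrightarrow> u t (u (inv\<^bsub>G\<^esub> t) (u t x)) = u t x"
  using u_mult[of t "inv\<^bsub>G\<^esub> t" x] by simp

text \<open>The third axiom at the vector \<open>u t x\<close>, where
  \<open>u_partial_isometry\<close> collapses the left-hand side: \<open>u\<close> is multiplicative
  up to the initial projection of \<open>u t\<close>.\<close>

lemma u_comp:
  assumes "s \<in> carrier G" "t \<in> carrier G" "x \<in> carrier H"
  shows "u s (u t x) = u (s \<otimes>\<^bsub>G\<^esub> t) (u (inv\<^bsub>G\<^esub> t) (u t x))"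
  using u_mult[of s t "u t x"] u_partial_isometry[of t x] assms by simp

section \<open>The kernel and its Schur reduction\<close>

definition kernel :: "'g \<Rightarrow> 'g \<Rightarrow> 'h \<Rightarrow> 'h" where
  "kernel s t = u (inv\<^bsub>G\<^esub> s \<otimes>\<^bsub>G\<^esub> t)"

lemma kernel_closed [simp]:
  "\<lbrakk>s \<in> carrier G; t \<in> carrier G; x \<in> carrier H\<rbrakk> \<Longrightarrow> kernel s t x \<in> carrier H"
  by (simp add: kernel_def)

lemma kernel_diff [simp]:
  "\<lbrakk>s \<in> carrier G; t \<in> carrier G; x \<in> carrier H; y \<in> carrier H\<rbrakk>
    \<Longrightarrow> kernel s t (H.diff x y) = H.diff (kernel s t x) (kernel s t y)"
  by (simp add: kernel_def)

lemma kernel_add [simp]: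
  "\<lbrakk>s \<in> carrier G; t \<in> carrier G; x \<in> carrier H; y \<in> carrier H\<rbrakk>
    \<Longrightarrow> kernel s t (x \<oplus>\<^bsub>H\<^esub> y) = kernel s t x \<oplus>\<^bsub>H\<^esub> kernel s t y"
  by (simp add: kernel_def)

lemma kernel_smult [simp]:
  "\<lbrakk>s \<in> carrier G; t \<in> carrier G; x \<in> carrier H\<rbrakk>
    \<Longrightarrow> kernel s t (c \<odot>\<^bsub>H\<^esub> x) = c \<odot>\<^bsub>H\<^esub> kernel s t x"
  by (simp add: kernel_def)

lemma kernel_self [simp]: "\<lbrakk>s \<in> carrier G; x \<in> carrier H\<rbrakk> \<Longrightarrow> kernel s s x = x"
  by (simp add: kernel_def)

lemma kernel_adjoint:
  "\<lbrakk>s \<in> carrier G; t \<in> carrier G; x \<in> carrier H; y \<in> carrier H\<rbrakk>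
    \<Longrightarrow> inner_prod H (kernel s t x) y = inner_prod H x (kernel t s y)"
  by (simp add: kernel_def u_adjoint G.inv_mult_group)

text \<open>In \<open>u_comp\<close> for \<open>inv r \<otimes> s\<close> and
  \<open>inv s \<otimes> t\<close> the product telescopes to
  \<open>inv r \<otimes> t\<close>.\<close>

lemma kernel_comp:
  "\<lbrakk>r \<in> carrier G; s \<in> carrier G; t \<in> carrier G; x \<in> carrier H\<rbrakk>
    \<Longrightarrow> kernel r s (kernel s t x) = kernel r t (kernel t s (kernel s t x))"
  using u_comp[of "inv\<^bsub>G\<^esub> r \<otimes>\<^bsub>G\<^esub> s" "inv\<^bsub>G\<^esub> s \<otimes>\<^bsub>G\<^esub> t" x]
  by (simp add: kernel_def G.inv_mult_group G.m_assoc G.inv_solve_left' flip: G.m_assoc[of s])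

lemma kernel_partial_isometry:
  "\<lbrakk>s \<in> carrier G; t \<in> carrier G; x \<in> carrier H\<rbrakk>
    \<Longrightarrow> kernel s t (kernel t s (kernel s t x)) = kernel s t x"
  using u_partial_isometry[of "inv\<^bsub>G\<^esub> s \<otimes>\<^bsub>G\<^esub> t" x]
  by (simp add: kernel_def G.inv_mult_group)

text \<open>The projection \<open>1 - e\<^sub>t\<close> of the introductory remark.\<close>

definition reduce :: "'g \<Rightarrow> 'g \<Rightarrow> 'h \<Rightarrow> 'h" where
  "reduce r t h = H.diff h (kernel t r (kernel r t h))"

lemma reduce_closed [simp]:
  "\<lbrakk>r \<in> carrier G; t \<in> carrier G; h \<in> carrier H\<rbrakk> \<Longrightarrow> reduce r t h \<in> carrier H"
  by (simp add: reduce_def)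

lemma reduce_self: "\<lbrakk>r \<in> carrier G; h \<in> carrier H\<rbrakk> \<Longrightarrow> reduce r r h = \<zero>\<^bsub>H\<^esub>"
  by (simp add: reduce_def H.diff_eq_minus H.M.r_neg a_minus_def)

text \<open>The Schur complement identity in weak form. Moved across the kernel, e_s becomes e_t and
  annihilates the reduced vector, so \<open>g\<close> need not be reduced; then k(s, t) e_t = k(s,
  r) k(r, t) gives the subtracted term.\<close>

lemma inner_kernel_reduce:
  assumes [simp]: "r \<in> carrier G" "s \<in> carrier G" "t \<in> carrier G" "g \<in> carrier H" "h \<in> carrier H"
  shows "inner_prod H (kernel s t (reduce r t h)) (reduce r s g)
    = inner_prod H (kernel s t h) g - inner_prod H (kernel r t h) (kernel r s g)"
proof -
  have "inner_prod H (kernel s t (reduce r t h)) (kernel s r (kernel r s g))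
      = inner_prod H (reduce r t h) (kernel t r (kernel r s g))"
    by (simp add: kernel_adjoint[of s t] kernel_comp[of t r s])
  also have "\<dots> = inner_prod H (kernel r t (reduce r t h)) (kernel r s g)"
    by (simp add: kernel_adjoint[of r t])
  also have "\<dots> = 0"
    by (simp add: reduce_def kernel_partial_isometry)
  finally have "inner_prod H (kernel s t (reduce r t h)) (reduce r s g)
      = inner_prod H (kernel s t (reduce r t h)) g"
    by (subst (2) reduce_def) simp
  also have "\<dots> = inner_prod H (kernel s t h) g - inner_prod H (kernel s r (kernel r t h)) g"
    by (simp add: reduce_def kernel_comp[of s r t])
  finally show ?thesis
    by (simp add: kernel_adjoint[of s r])
qed

lemma kernel_sum_nonneg:
  fixes n :: nat
  assumes "\<And>i. i < n \<Longrightarrow> t i \<in> carrier G" "\<And>i. i < n \<Longrightarrow> h i \<in> carrier H"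
  shows "(\<Sum>i<n. \<Sum>j<n. inner_prod H (kernel (t i) (t j) (h j)) (h i)) \<in> \<real>\<^sub>\<ge>\<^sub>0"
  using assms
\<comment> \<open>The induction hypothesis is needed for the reduced vectors, with the same group
  elements.\<close>
proof (induction n arbitrary: h)
  case 0
  show ?case by simp
next
  case (Suc n)
  \<comment> \<open>The eliminated element is the last one, \<open>t n\<close>. As
    \<open>h' n\<close> is zero, the reduced form has no terms with index \<open>n\<close>, and the
    remainder is the Gram sum of the vectors \<open>kernel (t n) (t j) (h j)\<close>.\<close>
  define h' where "h' j = reduce (t n) (t j) (h j)" for j
  have [simp]: "i < Suc n \<Longrightarrow> t i \<in> carrier G" "i < Suc n \<Longrightarrow> h i \<in> carrier H"
      "i < Suc n \<Longrightarrow> h' i \<in> carrier H" for i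
    using Suc.prems by (auto simp: h'_def)
  have [simp]: "t n \<in> carrier G" "h n \<in> carrier H" "h' n = \<zero>\<^bsub>H\<^esub>"
    using Suc.prems by (auto simp: h'_def reduce_self)
  have [simp]: "kernel (t i) (t n) \<zero>\<^bsub>H\<^esub> = \<zero>\<^bsub>H\<^esub>" if "i < Suc n" for i
    using that by (intro H.eq_zeroI) (simp_all add: kernel_adjoint)
  have "(\<Sum>i<Suc n. \<Sum>j<Suc n. inner_prod H (kernel (t i) (t j) (h j)) (h i))
      = (\<Sum>i<Suc n. \<Sum>j<Suc n. inner_prod H (kernel (t i) (t j) (h' j)) (h' i)
          + inner_prod H (kernel (t n) (t j) (h j)) (kernel (t n) (t i) (h i)))"
    by (intro sum.cong refl) (simp add: h'_def inner_kernel_reduce)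
  also have "\<dots> = (\<Sum>i<n. \<Sum>j<n. inner_prod H (kernel (t i) (t j) (h' j)) (h' i))
      + (\<Sum>i<Suc n. \<Sum>j<Suc n. inner_prod H (kernel (t n) (t j) (h j)) (kernel (t n) (t i) (h i)))"
    by (simp add: sum.distrib)
  also have "\<dots> \<in> \<real>\<^sub>\<ge>\<^sub>0"
  proof (rule nonneg_Reals_add_I)
    show "(\<Sum>i<n. \<Sum>j<n. inner_prod H (kernel (t i) (t j) (h' j)) (h' i)) \<in> \<real>\<^sub>\<ge>\<^sub>0"
      by (rule Suc.IH) simp_all
    show "(\<Sum>i<Suc n. \<Sum>j<Suc n. inner_prod H (kernel (t n) (t j) (h j)) (kernel (t n) (t i) (h i))) \<in> \<real>\<^sub>\<ge>\<^sub>0"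
      by (rule H.gram_sum_nonneg) simp
  qed
  finally show ?case .
qed

theorem positive_definite: "positive_definite G H u"
  using kernel_sum_nonneg rep
  by (auto simp: positive_definite_def kernel_def partial_representation_def)

end


section \<open>Dilation\<close>

text \<open>If \<open>F\<close> represents x, then moving A to its adjoint B shows that
  \<open>F \<circ> B\<close> represents A x; isometry of A preserves Cauchy sequences.\<close>

lemma (in semi_inner_completion) approx_translate:
  assumes AB: "\<And>v w. q (A v) w = q v (B w)" and A: "\<And>v w. q (A v) (A w) = q v w"
    and v: "approx v F"
  shows "approx (\<lambda>n. A (v n)) (\<lambda>w. F (B w))"
proof -
  have "snorm (diff (A (v m)) (A (v n))) = snorm (diff (v m) (v n))" for m n
    by (rule snorm_eqI) (simp_all add: A)
  then show ?thesis
    using v by (simp add: approx_def cauchy_def AB)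
qed

section \<open>The semi-inner product on formal combinations\<close>

context partial_rep
begin

text \<open>The value 0 outside the carriers makes all lists admissible, as the completion is formed
  over a whole type.\<close>

definition point_kernel :: "'g \<times> 'h \<Rightarrow> 'g \<times> 'h \<Rightarrow> complex" where
  "point_kernel = (\<lambda>(t, h) (s, g).
     if t \<in> carrier G \<and> h \<in> carrier H \<and> s \<in> carrier G \<and> g \<in> carrier H
     then inner_prod H (kernel s t h) g else 0)"

text \<open>An entry (c, t, h) stands for c times the translate by t of the vector h; this is the
  Kolmogorov inner product of such sums.\<close>

definition form :: "(complex \<times> 'g \<times> 'h) list \<Rightarrow> (complex \<times> 'g \<times> 'h) list \<Rightarrow> complex" where
  "form v w = (\<Sum>a\<leftarrow>v. \<Sum>b\<leftarrow>w. fst a * cnj (fst b) * point_kernel (snd a) (snd b))"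

definition scale :: "complex \<Rightarrow> (complex \<times> 'g \<times> 'h) list \<Rightarrow> (complex \<times> 'g \<times> 'h) list" where
  "scale c = map (\<lambda>a. (c * fst a, snd a))"

lemma point_kernel_cnj: "point_kernel y x = cnj (point_kernel x y)"
proof -
  have adj: "inner_prod H (kernel t s g) h = cnj (inner_prod H (kernel s t h) g)"
    if "t \<in> carrier G" "s \<in> carrier G" "h \<in> carrier H" "g \<in> carrier H" for s t g h
    using that kernel_adjoint[of t s g h] H.q_cnj[of "kernel s t h" g] by simp
  show ?thesis
    by (auto simp: point_kernel_def intro: adj split: prod.splits)
qed

lemma form_Nil [simp]: "form [] w = 0" "form v [] = 0"
  by (simp_all add: form_def)

lemma form_append_left: "form (v @ v') w = form v w + form v' w"
  by (simp add: form_def)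

lemma form_Cons_left: "form (a # v) w = form [a] w + form v w"
  by (simp add: form_def)

lemma form_Cons_right: "form v (b # w) = form v [b] + form v w"
  by (simp add: form_def sum_list_addf)

lemma form_scale_left: "form (scale c v) w = c * form v w"
  by (simp add: form_def scale_def o_def mult.assoc sum_list_const_mult)

lemma form_single [simp]: "form [a] [b] = fst a * cnj (fst b) * point_kernel (snd a) (snd b)"
  by (simp add: form_def)

lemma form_cnj: "form w v = cnj (form v w)"
proof (induction v)
  case (Cons a v)
  have "form w [a] = cnj (form [a] w)"
    by (induction w) (auto simp: form_def point_kernel_cnj[of "snd a"])
  then show ?case
    using Cons by (simp add: form_Cons_left[of a v] form_Cons_right[of w a v])
qed simp

lemma form_nonneg: "form v v \<in> \<real>\<^sub>\<ge>\<^sub>0"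
proof -
  \<comment> \<open>Entries outside the carriers become the zero vector at the unit and contribute
    nothing; elsewhere the coefficient is absorbed into the vector.\<close>
  define t where "t i = (case v ! i of (c, t, h) \<Rightarrow> if t \<in> carrier G \<and> h \<in> carrier H then t else \<one>\<^bsub>G\<^esub>)" for i
  define h where "h i = (case v ! i of (c, t, h) \<Rightarrow>
    if t \<in> carrier G \<and> h \<in> carrier H then c \<odot>\<^bsub>H\<^esub> h else \<zero>\<^bsub>H\<^esub>)" for i
  have t: "t i \<in> carrier G" and h: "h i \<in> carrier H" for i
    by (simp_all add: t_def h_def split: prod.split)
  have *: "fst (v ! j) * cnj (fst (v ! i)) * point_kernel (snd (v ! j)) (snd (v ! i))
      = inner_prod H (kernel (t i) (t j) (h j)) (h i)" for i j
  proof -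
    have "kernel (t i) (t j) \<zero>\<^bsub>H\<^esub> = \<zero>\<^bsub>H\<^esub>"
      using t by (intro H.eq_zeroI) (simp_all add: kernel_adjoint)
    then show ?thesis
      using t[of i] t[of j] h[of i] h[of j]
      by (auto simp: t_def h_def point_kernel_def split: prod.splits if_splits)
  qed
  have "form v v = (\<Sum>j<length v. \<Sum>i<length v.
      fst (v ! j) * cnj (fst (v ! i)) * point_kernel (snd (v ! j)) (snd (v ! i)))"
    by (simp add: form_def sum_list_sum_nth atLeast0LessThan)
  also have "\<dots> = (\<Sum>i<length v. \<Sum>j<length v. inner_prod H (kernel (t i) (t j) (h j)) (h i))"
    unfolding * by (rule sum.swap)
  also have "\<dots> \<in> \<real>\<^sub>\<ge>\<^sub>0"
    using t h by (intro kernel_sum_nonneg) auto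
  finally show ?thesis .
qed

sublocale L: semi_inner_completion "(@)" scale form
proof
  show "form y x = cnj (form x y)" for x y by (rule form_cnj)
qed (auto simp: form_append_left form_scale_left form_nonneg)

abbreviation He :: "((complex \<times> 'g \<times> 'h) list \<Rightarrow> complex) hilbert" where
  "He \<equiv> L.completion"

sublocale He: hilbert_space He
  by (rule L.hilbert_space_completion)

text \<open>Leaving points outside the carrier fixed makes the action laws and the invariance of
  \<open>form\<close> hold for all lists.\<close>

definition point_act :: "'g \<Rightarrow> 'g \<times> 'h \<Rightarrow> 'g \<times> 'h" where
  "point_act s = (\<lambda>(t, h). (if t \<in> carrier G then s \<otimes>\<^bsub>G\<^esub> t else t, h))"

definition act :: "'g \<Rightarrow> (complex \<times> 'g \<times> 'h) list \<Rightarrow> (complex \<times> 'g \<times> 'h) list" where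
  "act s = map (apsnd (point_act s))"

text \<open>A functional is an inner product with its second argument free, so translating the
  vector by s translates that argument by the inverse of s.\<close>

definition U :: "'g \<Rightarrow> ((complex \<times> 'g \<times> 'h) list \<Rightarrow> complex) \<Rightarrow> (complex \<times> 'g \<times> 'h) list \<Rightarrow> complex" where
  "U s F = (\<lambda>w. F (act (inv\<^bsub>G\<^esub> s) w))"

definition embed :: "'h \<Rightarrow> (complex \<times> 'g \<times> 'h) list \<Rightarrow> complex" where
  "embed x = form [(1, \<one>\<^bsub>G\<^esub>, x)]"

text \<open>The vector of \<open>H\<close> that represents the restriction of \<open>F\<close> to
  the embedded copy of \<open>H\<close>; it exists by \<open>proj_exists\<close>.\<close>

definition proj :: "((complex \<times> 'g \<times> 'h) list \<Rightarrow> complex) \<Rightarrow> 'h" where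
  "proj F = (SOME p. p \<in> carrier H \<and> (\<forall>y\<in>carrier H. inner_prod H p y = F [(1, \<one>\<^bsub>G\<^esub>, y)]))"

section \<open>Translations and the unitary representation\<close>

lemma act_single [simp]:
  "t \<in> carrier G \<Longrightarrow> act s [(c, t, h)] = [(c, s \<otimes>\<^bsub>G\<^esub> t, h)]"
  by (simp add: act_def point_act_def)

lemma act_one [simp]: "act \<one>\<^bsub>G\<^esub> v = v"
  by (auto simp: act_def point_act_def intro!: map_idI)

lemma act_mult: "\<lbrakk>s \<in> carrier G; t \<in> carrier G\<rbrakk> \<Longrightarrow> act (s \<otimes>\<^bsub>G\<^esub> t) v = act s (act t v)"
  by (auto simp: act_def point_act_def G.m_assoc)

text \<open>A common left translation cancels in \<open>inv r \<otimes> t\<close>.\<close>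

lemma form_act:
  assumes s: "s \<in> carrier G"
  shows "form (act s v) (act s w) = form v w"
proof -
  have "kernel (s \<otimes>\<^bsub>G\<^esub> r) (s \<otimes>\<^bsub>G\<^esub> t) = kernel r t" if "r \<in> carrier G" "t \<in> carrier G" for r t
    using s that by (simp add: kernel_def G.inv_mult_group G.m_assoc flip: G.m_assoc[of "inv\<^bsub>G\<^esub> s" s])
  then have "point_kernel (point_act s x) (point_act s y) = point_kernel x y" for x y
    using s by (auto simp: point_kernel_def point_act_def split: prod.splits)
  then show ?thesis
    by (simp add: form_def act_def o_def)
qed

lemma form_act_left:
  assumes s: "s \<in> carrier G"
  shows "form (act s v) w = form v (act (inv\<^bsub>G\<^esub> s) w)"
  using form_act[OF s, of v "act (inv\<^bsub>G\<^esub> s) w"] s by (simp flip: act_mult)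

lemma approx_U: "\<lbrakk>s \<in> carrier G; L.approx v F\<rbrakk> \<Longrightarrow> L.approx (\<lambda>n. act s (v n)) (U s F)"
  unfolding U_def by (rule L.approx_translate[OF form_act_left form_act])

lemma U_closed [simp]: "\<lbrakk>s \<in> carrier G; F \<in> L.limits\<rbrakk> \<Longrightarrow> U s F \<in> L.limits"
  by (erule L.limitsE) (rule L.limitsI[OF approx_U])

lemma inner_U:
  assumes s: "s \<in> carrier G" and "F \<in> L.limits" "K \<in> L.limits"
  shows "L.limit_inner (U s F) (U s K) = L.limit_inner F K"
proof -
  obtain v w where v: "L.approx v F" and w: "L.approx w K"
    using assms by (elim L.limitsE)
  show ?thesis
    using L.limit_inner_tendsto_q[OF approx_U[OF s v] approx_U[OF s w]] L.limit_inner_tendsto_q[OF v w]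
    unfolding form_act[OF s] by (rule LIMSEQ_unique)
qed

lemma U_one: "U \<one>\<^bsub>G\<^esub> F = F"
  by (simp add: U_def)

lemma U_mult: "\<lbrakk>s \<in> carrier G; t \<in> carrier G\<rbrakk> \<Longrightarrow> U (s \<otimes>\<^bsub>G\<^esub> t) F = U s (U t F)"
  by (simp add: U_def G.inv_mult_group act_mult)

lemma U_bounded:
  assumes s: "s \<in> carrier G"
  shows "bounded_operator He (U s)"
proof -
  have "linear_map He He (U s)"
    using U_closed[OF s] by (simp add: linear_map_def) (simp add: U_def)
  moreover have "hnorm He (U s F) \<le> 1 * hnorm He F" if "F \<in> carrier He" for F
    using that inner_U[OF s, of F F] by (simp add: hnorm_def)
  ultimately show ?thesis
    unfolding bounded_operator_def by blast
qed

lemma U_inverse: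
  assumes "s \<in> carrier G"
  shows "U s (U (inv\<^bsub>G\<^esub> s) F) = F" "U (inv\<^bsub>G\<^esub> s) (U s F) = F"
  using assms by (simp_all add: U_one flip: U_mult)

lemma U_unitary: "unitary_representation G He U"
proof -
  have "unitary_operator He (U s)" if s: "s \<in> carrier G" for s
    unfolding unitary_operator_def is_adjoint_def
  proof (intro conjI exI[of _ "U (inv\<^bsub>G\<^esub> s)"] ballI)
    fix F K assume F: "F \<in> carrier He" and K: "K \<in> carrier He"
    \<comment> \<open>Adjointness follows from isometry of \<open>U (inv s)\<close>, which undoes
      \<open>U s\<close> on the first argument.\<close>
    have "L.limit_inner (U (inv\<^bsub>G\<^esub> s) (U s F)) (U (inv\<^bsub>G\<^esub> s) K) = L.limit_inner (U s F) K"
      using s F K by (intro inner_U) simp_all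
    then show "inner_prod He (U s F) K = inner_prod He F (U (inv\<^bsub>G\<^esub> s) K)"
      by (simp add: U_inverse[OF s])
  qed (simp_all add: s U_bounded U_inverse)
  then show ?thesis
    by (simp add: unitary_representation_def U_one U_mult)
qed

section \<open>The embedding of H and the projection onto it\<close>

lemma embed_closed [simp]: "embed x \<in> L.limits"
  by (simp add: embed_def)

lemma inner_embed: "\<lbrakk>F \<in> L.limits\<rbrakk> \<Longrightarrow> L.limit_inner F (embed y) = F [(1, \<one>\<^bsub>G\<^esub>, y)]"
  by (simp add: embed_def)

lemma embed_hilbert: "hilbert_embedding H He embed"
proof -
  have "point_kernel (\<one>\<^bsub>G\<^esub>, x \<oplus>\<^bsub>H\<^esub> y) b
      = point_kernel (\<one>\<^bsub>G\<^esub>, x) b + point_kernel (\<one>\<^bsub>G\<^esub>, y) b"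
    if "x \<in> carrier H" "y \<in> carrier H" for x y b
    using that by (simp add: point_kernel_def split: prod.split)
  then have add: "embed (x \<oplus>\<^bsub>H\<^esub> y) w = embed x w + embed y w"
    if "x \<in> carrier H" "y \<in> carrier H" for x y w
    using that by (induction w) (simp_all add: embed_def form_def distrib_left)
  have "point_kernel (\<one>\<^bsub>G\<^esub>, c \<odot>\<^bsub>H\<^esub> x) b = c * point_kernel (\<one>\<^bsub>G\<^esub>, x) b"
    if "x \<in> carrier H" for c x b
    using that by (simp add: point_kernel_def split: prod.split)
  then have smult: "embed (c \<odot>\<^bsub>H\<^esub> x) w = c * embed x w" if "x \<in> carrier H" for c x w
    using that by (induction w) (simp_all add: embed_def form_def distrib_left)
  have "L.limit_inner (embed x) (embed y) = inner_prod H x y" if "x \<in> carrier H" "y \<in> carrier H" for x y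
    using that by (subst inner_embed) (simp_all add: embed_def point_kernel_def)
  then show ?thesis
    by (auto simp: hilbert_embedding_def linear_map_def add smult)
qed

text \<open>On a valid entry (c, t, h) the projection is explicit, namely c times
  \<open>u t h\<close>; an invalid entry is orthogonal to everything.\<close>

lemma proj_exists_form: "\<exists>p\<in>carrier H. \<forall>y\<in>carrier H. inner_prod H p y = form v [(1, \<one>\<^bsub>G\<^esub>, y)]"
proof (induction v)
  case Nil
  show ?case by (intro bexI[of _ "\<zero>\<^bsub>H\<^esub>"]) auto
next
  case (Cons a v)
  obtain c t h where a: "a = (c, t, h)" by (cases a)
  obtain p where p: "p \<in> carrier H" "\<And>y. y \<in> carrier H \<Longrightarrow> inner_prod H p y = form v [(1, \<one>\<^bsub>G\<^esub>, y)]"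
    using Cons by blast
  show ?case
  proof (cases "t \<in> carrier G \<and> h \<in> carrier H")
    case True
    with p show ?thesis
      by (intro bexI[of _ "c \<odot>\<^bsub>H\<^esub> kernel \<one>\<^bsub>G\<^esub> t h \<oplus>\<^bsub>H\<^esub> p"])
        (simp_all add: a form_Cons_left[of _ v] point_kernel_def)
  next
    case False
    with p show ?thesis
      by (intro bexI[of _ p]) (auto simp: a form_Cons_left[of _ v] point_kernel_def)
  qed
qed

text \<open>The projection contracts norms, so the projections \<open>p n\<close> of the
  approximants form a Cauchy sequence, and completeness of \<open>H\<close> supplies the
  vector.\<close>

lemma proj_exists:
  assumes "F \<in> L.limits"
  shows "\<exists>p\<in>carrier H. \<forall>y\<in>carrier H. inner_prod H p y = F [(1, \<one>\<^bsub>G\<^esub>, y)]"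
proof -
  obtain v where v: "L.approx v F" using assms by (rule L.limitsE)
  have "\<forall>n. \<exists>p. p \<in> carrier H \<and> (\<forall>y\<in>carrier H. inner_prod H p y = form (v n) [(1, \<one>\<^bsub>G\<^esub>, y)])"
    using proj_exists_form by blast
  from choice[OF this] obtain p where p: "\<And>n. p n \<in> carrier H"
      "\<And>n y. y \<in> carrier H \<Longrightarrow> inner_prod H (p n) y = form (v n) [(1, \<one>\<^bsub>G\<^esub>, y)]"
    by blast
  have "H.snorm (H.diff (p m) (p n)) \<le> L.snorm (L.diff (v m) (v n))" for m n
  proof -
    let ?d = "H.diff (p m) (p n)" and ?D = "L.diff (v m) (v n)"
    have d: "?d \<in> carrier H" using p(1) by simp
    have "form [(1, \<one>\<^bsub>G\<^esub>, ?d)] [(1, \<one>\<^bsub>G\<^esub>, ?d)] = inner_prod H ?d ?d"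
      using p(1) by (simp add: point_kernel_def del: H.q_diff_left H.q_diff_right)
    then have s: "L.snorm [(1, \<one>\<^bsub>G\<^esub>, ?d)] = H.snorm ?d"
      unfolding L.snorm_def H.snorm_def by (rule arg_cong)
    \<comment> \<open>Testing the difference against itself: since the embedding preserves norms,
      Cauchy-Schwarz bounds its squared norm by its norm times that of \<open>?D\<close>.\<close>
    have "inner_prod H ?d ?d = form ?D [(1, \<one>\<^bsub>G\<^esub>, ?d)]"
      by (simp only: H.q_diff_left[OF p(1) p(1) d] p(2)[OF d] L.q_diff_left UNIV_I)
    then have "(H.snorm ?d)\<^sup>2 = cmod (form ?D [(1, \<one>\<^bsub>G\<^esub>, ?d)])"
      using H.q_self[OF d] by (metis abs_power2 norm_of_real)
    also have "\<dots> \<le> L.snorm ?D * H.snorm ?d"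
      using L.Cauchy_Schwarz[of ?D "[(1, \<one>\<^bsub>G\<^esub>, ?d)]"] s by simp
    finally show ?thesis
      using H.snorm_nonneg[OF d] by (cases "H.snorm ?d = 0") (auto simp: power2_eq_square)
  qed
  then have "H.cauchy p"
    using L.approx_cauchy[OF v] unfolding H.cauchy_def L.cauchy_def by (meson le_less_trans)
  then obtain x where x: "x \<in> carrier H" "(\<lambda>n. H.snorm (H.diff (p n) x)) \<longlonglongrightarrow> 0"
    using H.cauchy_convergent p(1) by blast
  have "inner_prod H x y = F [(1, \<one>\<^bsub>G\<^esub>, y)]" if "y \<in> carrier H" for y
    using H.inner_tendsto[OF x(1) p(1) x(2) that] L.approx_tendsto[OF v, of "[(1, \<one>\<^bsub>G\<^esub>, y)]"]
    unfolding p(2)[OF that] by (rule LIMSEQ_unique)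
  with x(1) show ?thesis by blast
qed

lemma
  assumes "F \<in> L.limits"
  shows proj_closed [simp]: "proj F \<in> carrier H"
    and inner_proj: "y \<in> carrier H \<Longrightarrow> inner_prod H (proj F) y = F [(1, \<one>\<^bsub>G\<^esub>, y)]"
  using someI_ex[of "\<lambda>p. p \<in> carrier H \<and> (\<forall>y\<in>carrier H. inner_prod H p y = F [(1, \<one>\<^bsub>G\<^esub>, y)])"]
    proj_exists[OF assms] unfolding proj_def by blast+

lemma proj_orthogonal: "orthogonal_projection H He embed proj"
  unfolding orthogonal_projection_def
proof (intro ballI conjI)
  fix F y assume F: "F \<in> carrier He" and y: "y \<in> carrier H"
  have "inner_prod He (He.diff F (embed (proj F))) (embed y)
      = inner_prod He F (embed y) - inner_prod He (embed (proj F)) (embed y)"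
    using F by (intro He.q_diff_left) simp_all
  also have "inner_prod He (embed (proj F)) (embed y) = inner_prod H (proj F) y"
    using F y embed_hilbert by (auto simp: hilbert_embedding_def)
  also have "inner_prod He F (embed y) = inner_prod H (proj F) y"
    using F y by (simp add: inner_embed inner_proj)
  also have "He.diff F (embed (proj F)) = F \<ominus>\<^bsub>He\<^esub> embed (proj F)"
    using F by (intro He.diff_eq_minus) simp_all
  finally show "inner_prod He (F \<ominus>\<^bsub>He\<^esub> embed (proj F)) (embed y) = 0"
    by simp
qed simp

text \<open>Against \<open>y\<close>, the left-hand side is the kernel at \<open>inv t\<close> and
  the unit, which is \<open>u t\<close>.\<close>

lemma proj_U_embed:
  assumes "t \<in> carrier G" "x \<in> carrier H"
  shows "proj (U t (embed x)) = u t x"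
  using assms
  by (intro H.inner_eqI) (simp_all add: inner_proj, simp_all add: U_def embed_def point_kernel_def kernel_def)

text \<open>A vector of the dilation is determined by its coefficients along the translates of \<open>H\<close>, so that
  the dilation can be realized by functions from the group to \<open>H\<close>.\<close>

definition coefficients :: "((complex \<times> 'g \<times> 'h) list \<Rightarrow> complex) \<Rightarrow> 'g \<Rightarrow> 'h" where
  "coefficients F t = proj (U (inv\<^bsub>G\<^esub> t) F)"

text \<open>Limit functionals are additive and conjugate-homogeneous, hence determined on single
  entries with coefficient 1.\<close>

lemma limits_eqI:
  assumes F: "F \<in> L.limits" and K: "K \<in> L.limits"
    and eq: "\<And>t h. \<lbrakk>t \<in> carrier G; h \<in> carrier H\<rbrakk> \<Longrightarrow> F [(1, t, h)] = K [(1, t, h)]"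
  shows "F = K"
proof
  fix w show "F w = K w"
  proof (induction w)
    case Nil
    show ?case using L.limits_add[OF F, of "[]" "[]"] L.limits_add[OF K, of "[]" "[]"] by simp
  next
    case (Cons a w)
    obtain c t h where a: "a = (c, t, h)" by (cases a)
    have "F [(1, t, h)] = K [(1, t, h)]"
    proof (cases "t \<in> carrier G \<and> h \<in> carrier H")
      case False
      \<comment> \<open>At a point outside the carriers every approximant vanishes, hence so does
        every limit.\<close>
      then have "form v [(1, t, h)] = 0" for v
        by (induction v) (auto simp: form_Cons_left[of _ "_ # _"] form_def point_kernel_def case_prod_beta)
      then have vanish: "E [(1, t, h)] = 0" if "E \<in> L.limits" for E
        using that by (elim L.limitsE) (drule L.approx_tendsto[of _ _ "[(1, t, h)]"], simp add: LIMSEQ_const_iff)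
      show ?thesis using vanish[OF F] vanish[OF K] by simp
    qed (use eq in auto)
    then show ?case
      using L.limits_add[OF F, of "scale c [(1, t, h)]" w] L.limits_add[OF K, of "scale c [(1, t, h)]" w]
        L.limits_scale[OF F, of c "[(1, t, h)]"] L.limits_scale[OF K, of c "[(1, t, h)]"] Cons.IH
      by (simp add: a scale_def)
  qed
qed

text \<open>Pairing the coefficient at t with h recovers the value of the functional at
  \<open>[(1, t, h)]\<close>, and these values suffice.\<close>

lemma inj_coefficients: "inj_on coefficients L.limits"
proof (rule inj_onI)
  fix F K assume F: "F \<in> L.limits" and K: "K \<in> L.limits" and eq: "coefficients F = coefficients K"
  have *: "inner_prod H (coefficients E t) h = E [(1, t, h)]"
    if "E \<in> L.limits" "t \<in> carrier G" "h \<in> carrier H" for E t h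
    using that by (simp add: coefficients_def inner_proj) (simp add: U_def)
  show "F = K"
    using F K by (rule limits_eqI) (metis * F K eq)
qed

end


section \<open>Transport of structure\<close>

definition transport :: "('a \<Rightarrow> 'b) \<Rightarrow> 'a hilbert \<Rightarrow> 'b hilbert" where
  "transport f H = (let g = inv_into (carrier H) f in
     \<lparr>carrier = f ` carrier H, monoid.mult = undefined, one = undefined, ring.zero = f \<zero>\<^bsub>H\<^esub>,
      ring.add = (\<lambda>x y. f (g x \<oplus>\<^bsub>H\<^esub> g y)), module.smult = (\<lambda>c x. f (c \<odot>\<^bsub>H\<^esub> g x)),
      inner_prod = (\<lambda>x y. inner_prod H (g x) (g y))\<rparr>)"

locale hilbert_transport = hilbert_space H for H :: "'a hilbert" (structure) +
  fixes f :: "'a \<Rightarrow> 'b"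
  assumes inj: "inj_on f (carrier H)"
begin

abbreviation "K \<equiv> transport f H"

abbreviation "g \<equiv> inv_into (carrier H) f"

lemma g_f [simp]: "x \<in> carrier H \<Longrightarrow> g (f x) = x"
  using inj by (rule inv_into_f_f)

lemma transport_simps [simp]:
  "carrier K = f ` carrier H" "\<zero>\<^bsub>K\<^esub> = f \<zero>"
  "\<lbrakk>x \<in> carrier H; y \<in> carrier H\<rbrakk> \<Longrightarrow> f x \<oplus>\<^bsub>K\<^esub> f y = f (x \<oplus> y)"
  "x \<in> carrier H \<Longrightarrow> c \<odot>\<^bsub>K\<^esub> f x = f (c \<odot> x)"
  "\<lbrakk>x \<in> carrier H; y \<in> carrier H\<rbrakk> \<Longrightarrow> inner_prod K (f x) (f y) = inner_prod H x y"
  by (simp_all add: transport_def Let_def)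

lemma module_transport: "module complex_field K"
proof (rule complex_moduleI)
  show "(- 1) \<odot>\<^bsub>K\<^esub> x \<oplus>\<^bsub>K\<^esub> x = \<zero>\<^bsub>K\<^esub>" if "x \<in> carrier K" for x
    using that smult_l_minus[of 1] smult_one by (auto simp: M.l_neg)
  show "(a + b) \<odot>\<^bsub>K\<^esub> x = a \<odot>\<^bsub>K\<^esub> x \<oplus>\<^bsub>K\<^esub> b \<odot>\<^bsub>K\<^esub> x" if "x \<in> carrier K" for a b x
    using that smult_l_distr by auto
  show "(a * b) \<odot>\<^bsub>K\<^esub> x = a \<odot>\<^bsub>K\<^esub> (b \<odot>\<^bsub>K\<^esub> x)" if "x \<in> carrier K" for a b x
    using that smult_assoc1 by auto
  show "1 \<odot>\<^bsub>K\<^esub> x = x" if "x \<in> carrier K" for x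
    using that smult_one by auto
qed (auto simp: M.a_ac smult_r_distr)

lemma transport_minus: "\<lbrakk>x \<in> carrier H; y \<in> carrier H\<rbrakk> \<Longrightarrow> f x \<ominus>\<^bsub>K\<^esub> f y = f (x \<ominus> y)"
  by (simp add: minus_eq_smult[OF module_transport] minus_eq_smult[OF module_axioms])

lemma hnorm_transport: "x \<in> carrier H \<Longrightarrow> hnorm K (f x) = hnorm H x"
  by (simp add: hnorm_def)

lemma hilbert_space_transport: "hilbert_space K"
proof (intro hilbert_space.intro module_transport hilbert_space_axioms.intro)
  fix \<xi> :: "nat \<Rightarrow> 'b" assume \<xi>_closed: "\<And>n. \<xi> n \<in> carrier K"
    and cauchy: "\<And>e. e > 0 \<Longrightarrow> \<exists>N. \<forall>m\<ge>N. \<forall>n\<ge>N. hnorm K (\<xi> m \<ominus>\<^bsub>K\<^esub> \<xi> n) < e"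
  have "\<forall>n. \<exists>x. x \<in> carrier H \<and> \<xi> n = f x"
    using \<xi>_closed by (auto simp: image_iff Bex_def)
  from choice[OF this] obtain \<eta> where \<eta>: "\<And>n. \<eta> n \<in> carrier H" and \<xi>: "\<xi> = (\<lambda>n. f (\<eta> n))"
    by blast
  have norm: "hnorm K (f x \<ominus>\<^bsub>K\<^esub> f y) = hnorm H (x \<ominus> y)" if "x \<in> carrier H" "y \<in> carrier H" for x y
    using that by (simp add: transport_minus hnorm_transport)
  have "\<exists>x\<in>carrier H. (\<lambda>n. hnorm H (\<eta> n \<ominus> x)) \<longlonglongrightarrow> 0"
    using cauchy by (intro complete \<eta>) (simp_all add: \<xi> norm \<eta>)
  then show "\<exists>x\<in>carrier K. (\<lambda>n. hnorm K (\<xi> n \<ominus>\<^bsub>K\<^esub> x)) \<longlonglongrightarrow> 0"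
    by (auto simp: \<xi> norm \<eta>)
next
  fix x y assume "x \<in> carrier K" "y \<in> carrier K"
  then show "inner_prod K y x = cnj (inner_prod K x y)"
    by (auto intro: inner_cnj)
next
  fix x assume "x \<in> carrier K" "inner_prod K x x = 0"
  then show "x = \<zero>\<^bsub>K\<^esub>"
    using inner_definite by fastforce
qed (auto simp del: complex_nonneg_Reals_iff intro: inner_nonneg)

lemma hilbert_embedding_transport:
  assumes "hilbert_embedding E H i"
  shows "hilbert_embedding E K (\<lambda>x. f (i x))"
  using assms by (auto simp: hilbert_embedding_def linear_map_def)

lemma orthogonal_projection_transport:
  assumes "hilbert_embedding E H i" "orthogonal_projection E H i P"
  shows "orthogonal_projection E K (\<lambda>x. f (i x)) (\<lambda>x. P (g x))"
  using assms
  by (auto simp: orthogonal_projection_def hilbert_embedding_def linear_map_def transport_minus)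

lemma bounded_operator_transport:
  assumes "bounded_operator H T"
  shows "bounded_operator K (\<lambda>x. f (T (g x)))"
  using assms by (auto simp: bounded_operator_def linear_map_def hnorm_transport)

lemma is_adjoint_transport:
  assumes "bounded_operator H T" "is_adjoint H T S"
  shows "is_adjoint K (\<lambda>x. f (T (g x))) (\<lambda>x. f (S (g x)))"
  using assms bounded_operator_transport[of S]
  by (auto simp: is_adjoint_def bounded_operator_def linear_map_def)

lemma unitary_operator_transport:
  assumes "unitary_operator H T"
  shows "unitary_operator K (\<lambda>x. f (T (g x)))"
proof -
  obtain S where T: "bounded_operator H T" and S: "is_adjoint H T S"
      and inv: "\<And>x. x \<in> carrier H \<Longrightarrow> T (S x) = x \<and> S (T x) = x"
    using assms by (auto simp: unitary_operator_def)
  have [simp]: "T x \<in> carrier H" "S x \<in> carrier H" if "x \<in> carrier H" for x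
    using that T S by (auto simp: is_adjoint_def bounded_operator_def linear_map_def)
  show ?thesis
    unfolding unitary_operator_def
  proof (intro conjI exI)
    show "is_adjoint K (\<lambda>x. f (T (g x))) (\<lambda>x. f (S (g x)))"
      using T S by (rule is_adjoint_transport)
  qed (use bounded_operator_transport[OF T] inv in auto)
qed

lemma unitary_representation_transport:
  assumes G: "group G" and U: "unitary_representation G H U"
  shows "unitary_representation G K (\<lambda>t x. f (U t (g x)))"
proof -
  have "U t x \<in> carrier H" if "t \<in> carrier G" "x \<in> carrier H" for t x
    using that U by (auto simp: unitary_representation_def unitary_operator_def bounded_operator_def linear_map_def)
  then show ?thesis
    using U by (auto simp: unitary_representation_def unitary_operator_transport)
qed

end

theorem proposition4p20:
  fixes G :: "'g monoid" and H :: "'h hilbert" and u :: "'g \<Rightarrow> 'h \<Rightarrow> 'h"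
  assumes "amenable_group G"
    and "hilbert_space H"
    and "partial_representation G H u"
  shows "(\<exists>(He :: ('g \<Rightarrow> 'h) hilbert) i P ue.
            hilbert_space He \<and> hilbert_embedding H He i \<and>
            orthogonal_projection H He i P \<and>
            unitary_representation G He ue \<and>
            (\<forall>t\<in>carrier G. \<forall>x\<in>carrier H. u t x = P (ue t (i x))))
         \<and> positive_definite G H u"
proof -
  have G: "group G" using assms(1) by (simp add: amenable_group_def)
  interpret partial_rep G H u
    using G assms(2,3) by (intro partial_rep.intro partial_rep_axioms.intro)
  \<comment> \<open>This moves the dilation from functionals on lists to the type
    \<open>'g \<Rightarrow> 'h\<close>.\<close>
  interpret T: hilbert_transport He coefficients
    by unfold_locales (simp add: inj_coefficients)
  have g: "T.g (coefficients F) = F" if "F \<in> L.limits" for F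
    using T.g_f[of F] that by simp
  \<comment> \<open>Each \<open>T.g\<close> meets the \<open>coefficients\<close> of a vector of the
    dilation and cancels it, which leaves \<open>proj_U_embed\<close>.\<close>
  have "u t x = proj (T.g (coefficients (U t (T.g (coefficients (embed x))))))"
    if "t \<in> carrier G" "x \<in> carrier H" for t x
    using that by (simp only: g embed_closed U_closed proj_U_embed)
  then show ?thesis
    by (intro conjI exI[of _ T.K] exI[of _ "\<lambda>x. coefficients (embed x)"] exI[of _ "\<lambda>F. proj (T.g F)"]
        exI[of _ "\<lambda>t F. coefficients (U t (T.g F))"] ballI T.hilbert_space_transport
        T.hilbert_embedding_transport embed_hilbert T.orthogonal_projection_transport proj_orthogonal
        T.unitary_representation_transport G U_unitary positive_definite)
qed

end
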